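(* CWCM with top-truncated votes is solvable in polynomial time, for any number of candidates (the number of candidates is not bounded and is part of the input), for each of the rules $\text{plurality}_{\downarrow}$ and $\text{veto}_{\downarrow}$ (plurality and veto with top-truncated ballots evaluated by the round-down scheme).
   Context: An election has a finite set $C$ of $m$ candidates and voters with non-negative integer weights; a vote of weight $w$ counts as $w$ identical votes. A top-truncated vote is a linear order over a non-empty subset of $C$; the unranked candidates are regarded as tied with each other and below all ranked ones. A complete vote ranks all of $C$ and is a special case. A positional scoring rule is given by a scoring vector $\langle\alpha_1,\dots,\alpha_m\rangle$ with $\alpha_1\ge\dots\ge\alpha_m$; in a complete vote a candidate in position $i$ receives $\alpha_i$ points, and the winners are the candidates with highest total (weighted) score. Plurality has vector $\langle 1,0,\dots,0\rangle$, veto has vector $\langle 1,\dots,1,0\rangle$. Round-down scheme $X_{\downarrow}$: in a vote ranking only $k<m$ candidates, the candidate in position $i\le k$ receives $\alpha_{m-(k-i)-1}$ and every unranked candidate receives $\alpha_m$. CWCM (Constructive Weighted Coalitional Manipulation) with top-truncated votes: given a set $S$ of weighted votes of the non-manipulators (possibly top-truncated), the weights of a set $T$ of manipulators' votes, and a preferred candidate $p$, decide whether the votes in $T$ can be cast (each as an arbitrary top-truncated or complete vote) so that $p$ is a winner (not necessarily unique) of the election with votes $S\cup T$. Weights are encoded in binary. *)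

theory Defs
  imports "HOL-Computational_Algebra.Polynomial"
begin

section \<open>Deterministic multi-tape Turing machines and polynomial time\<close>

text \<open>
  States and tape symbols are initial segments of the natural numbers, and 0 is the blank. The
  transition function is only relevant on the finitely many pairs of a state and a tuple of read
  symbols that respect these bounds, so it amounts to a finite table.
\<close>

datatype dir = Left | Stay | Right

record tm =
  n_tapes :: nat
  n_states :: nat
  n_symbols :: nat
  start :: nat
  accept :: nat
  reject :: nat
  trans :: "nat \<Rightarrow> nat list \<Rightarrow> nat \<times> (nat \<times> dir) list"

definition turing_machine :: "tm \<Rightarrow> bool" where
  "turing_machine M \<longleftrightarrow>
     n_tapes M \<ge> 1 \<and> n_symbols M \<ge> 1 \<and>
     start M < n_states M \<and> accept M < n_states M \<and> reject M < n_states M \<and>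
     accept M \<noteq> reject M \<and>
     (\<forall>q rs. q < n_states M \<and> length rs = n_tapes M \<and> (\<forall>r\<in>set rs. r < n_symbols M) \<longrightarrow>
        (case trans M q rs of (q', acts) \<Rightarrow>
           q' < n_states M \<and> length acts = n_tapes M \<and> (\<forall>(s, d)\<in>set acts. s < n_symbols M)))"

text \<open>
  A tape is infinite in both directions. The triple \<open>(l, s, r)\<close> has the head on symbol \<open>s\<close>, the
  symbols of \<open>l\<close> to its left and those of \<open>r\<close> to its right (both listed starting next to the
  head), and blanks everywhere else.
\<close>

type_synonym tape = "nat list \<times> nat \<times> nat list"

fun read_head :: "tape \<Rightarrow> nat" where
  "read_head (l, s, r) = s"

fun write_head :: "nat \<Rightarrow> tape \<Rightarrow> tape" where
  "write_head a (l, s, r) = (l, a, r)"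

fun move_head :: "dir \<Rightarrow> tape \<Rightarrow> tape" where
  "move_head Stay t = t"
| "move_head Left ([], s, r) = ([], 0, s # r)"
| "move_head Left (a # l, s, r) = (l, a, s # r)"
| "move_head Right (l, s, []) = (s # l, 0, [])"
| "move_head Right (l, s, a # r) = (s # l, a, r)"

fun input_tape :: "nat list \<Rightarrow> tape" where
  "input_tape [] = ([], 0, [])"
| "input_tape (a # w) = ([], a, w)"

type_synonym config = "nat \<times> tape list"

definition initial :: "tm \<Rightarrow> nat list \<Rightarrow> config" where
  "initial M w = (start M, input_tape w # replicate (n_tapes M - 1) (input_tape []))"

fun step :: "tm \<Rightarrow> config \<Rightarrow> config" where
  "step M (q, ts) =
     (if q = accept M \<or> q = reject M then (q, ts)
      else case trans M q (map read_head ts) of (q', acts) \<Rightarrow>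
             (q', map2 (\<lambda>(s, d) t. move_head d (write_head s t)) acts ts))"

definition decides_in_time ::
    "tm \<Rightarrow> nat set \<Rightarrow> nat list set \<Rightarrow> (nat \<Rightarrow> nat) \<Rightarrow> bool" where
  "decides_in_time M \<Sigma> L T \<longleftrightarrow>
     (\<forall>w\<in>lists \<Sigma>. \<exists>n\<le>T (length w).
        fst ((step M ^^ n) (initial M w)) = (if w \<in> L then accept M else reject M))"

text \<open>Membership in the class P of a language over the finite alphabet \<open>\<Sigma>\<close>.\<close>

definition poly_time_decidable :: "nat set \<Rightarrow> nat list set \<Rightarrow> bool" where
  "poly_time_decidable \<Sigma> L \<longleftrightarrow> L \<subseteq> lists \<Sigma> \<and>
     (\<exists>M p. turing_machine M \<and> \<Sigma> \<subseteq> {1..<n_symbols M} \<and>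
        decides_in_time M \<Sigma> L (\<lambda>n. poly (p :: nat poly) n))"


section \<open>Elections with top-truncated votes\<close>

text \<open>A vote lists its ranked candidates, the most preferred one first.\<close>

definition top_truncated_vote :: "'c set \<Rightarrow> 'c list \<Rightarrow> bool" where
  "top_truncated_vote C v \<longleftrightarrow> v \<noteq> [] \<and> distinct v \<and> set v \<subseteq> C"

text \<open>
  A scoring rule gives for every number \<open>m\<close> of candidates its scoring vector, as a function of the
  positions \<open>1, \<dots>, m\<close>.
\<close>

type_synonym scoring_rule = "nat \<Rightarrow> nat \<Rightarrow> nat"

definition plurality :: scoring_rule where
  "plurality m i = (if i = 1 then 1 else 0)"

definition veto :: scoring_rule where
  "veto m i = (if i = m then 0 else 1)"

text \<open>Positions are counted from 1.\<close>

definition position :: "'c list \<Rightarrow> 'c \<Rightarrow> nat" where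
  "position v c = length (takeWhile (\<lambda>d. d \<noteq> c) v) + 1"

definition round_down :: "scoring_rule \<Rightarrow> nat \<Rightarrow> 'c list \<Rightarrow> 'c \<Rightarrow> nat" where
  "round_down \<alpha> m v c =
     (let k = length v; i = position v c in
      if c \<notin> set v then \<alpha> m m
      else if k < m then \<alpha> m (m - (k - i) - 1)
      else \<alpha> m i)"

definition score :: "scoring_rule \<Rightarrow> 'c set \<Rightarrow> (nat \<times> 'c list) list \<Rightarrow> 'c \<Rightarrow> nat" where
  "score \<alpha> C V c = (\<Sum>(w, v)\<leftarrow>V. w * round_down \<alpha> (card C) v c)"

definition winners :: "scoring_rule \<Rightarrow> 'c set \<Rightarrow> (nat \<times> 'c list) list \<Rightarrow> 'c set" where
  "winners \<alpha> C V = {c \<in> C. \<forall>d\<in>C. score \<alpha> C V d \<le> score \<alpha> C V c}"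


section \<open>Constructive weighted coalitional manipulation\<close>

text \<open>
  Candidates are named by natural numbers, and an instance lists all of them explicitly. Votes of
  non-manipulators come with their weights; of the manipulators only the weights are given.
\<close>

record cwcm =
  preferred :: nat
  candidates :: "nat list"
  fixed_votes :: "(nat \<times> nat list) list"
  manipulator_weights :: "nat list"

definition cwcm_instance :: "cwcm \<Rightarrow> bool" where
  "cwcm_instance I \<longleftrightarrow>
     distinct (candidates I) \<and> preferred I \<in> set (candidates I) \<and>
     (\<forall>(w, v)\<in>set (fixed_votes I). top_truncated_vote (set (candidates I)) v)"

definition manipulable :: "scoring_rule \<Rightarrow> cwcm \<Rightarrow> bool" where
  "manipulable \<alpha> I \<longleftrightarrow>
     (\<exists>vs. length vs = length (manipulator_weights I) \<and>
        (\<forall>v\<in>set vs. top_truncated_vote (set (candidates I)) v) \<and>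
        preferred I \<in> winners \<alpha> (set (candidates I))
          (fixed_votes I @ zip (manipulator_weights I) vs))"

text \<open>
  Instances are words over the alphabet \<open>{1, 2, 3, 4}\<close>: 1 and 2 are the binary digits zero and one,
  3 terminates a number and 4 terminates a list. Numbers are written in binary with the least
  significant digit first and without superfluous zeros.
\<close>

fun binary :: "nat \<Rightarrow> nat list" where
  "binary n = (if n = 0 then [] else (n mod 2 + 1) # binary (n div 2))"

declare binary.simps [simp del]

definition enc_number :: "nat \<Rightarrow> nat list" where
  "enc_number n = binary n @ [3]"

definition enc_numbers :: "nat list \<Rightarrow> nat list" where
  "enc_numbers ns = concat (map enc_number ns) @ [4]"

definition enc_votes :: "(nat \<times> nat list) list \<Rightarrow> nat list" where
  "enc_votes V = concat (map (\<lambda>(w, v). enc_number w @ enc_numbers v) V) @ [4]"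

definition encode :: "cwcm \<Rightarrow> nat list" where
  "encode I =
     enc_number (preferred I) @ enc_numbers (candidates I) @
     enc_votes (fixed_votes I) @ enc_numbers (manipulator_weights I)"

definition CWCM_round_down :: "scoring_rule \<Rightarrow> nat list set" where
  "CWCM_round_down \<alpha> = {encode I | I. cwcm_instance I \<and> manipulable \<alpha> I}"


section \<open>The encoding is unambiguous\<close>

lemma binary_digits: "x \<in> set (binary n) \<Longrightarrow> x = 1 \<or> x = 2"
proof (induction n rule: binary.induct)
  case (1 n)
  show ?case
  proof (cases "n = 0")
    case True
    then show ?thesis using "1.prems" binary.simps[of 0] by simp
  next
    case False
    then have "x = n mod 2 + 1 \<or> x \<in> set (binary (n div 2))"
      using "1.prems" by (simp add: binary.simps[of n])
    then show ?thesis using "1.IH" False by auto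
  qed
qed

lemma binary_inject: "binary a = binary b \<Longrightarrow> a = b"
proof (induction a arbitrary: b rule: binary.induct)
  case (1 a)
  show ?case
  proof (cases "a = 0 \<or> b = 0")
    case True
    then show ?thesis
      using "1.prems" by (auto simp: binary.simps[of a] binary.simps[of b] split: if_splits)
  next
    case False
    then have "a mod 2 = b mod 2" "binary (a div 2) = binary (b div 2)"
      using "1.prems" by (simp_all add: binary.simps[of a] binary.simps[of b])
    moreover have "a div 2 = b div 2"
      using "1.IH" False calculation(2) by blast
    ultimately show ?thesis by (metis div_mult_mod_eq)
  qed
qed

lemma terminated_inject:
  assumes "xs @ a # us = ys @ a # vs" "a \<notin> set xs" "a \<notin> set ys"
  shows "xs = ys \<and> us = vs"
  using assms
proof (induction xs arbitrary: ys)
  case Nil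
  then show ?case by (cases ys) auto
next
  case (Cons x xs)
  then show ?case by (cases ys) auto
qed

lemma enc_number_inject [simp]:
  "enc_number a @ us = enc_number b @ vs \<longleftrightarrow> a = b \<and> us = vs"
proof
  assume "enc_number a @ us = enc_number b @ vs"
  then have eq: "binary a @ 3 # us = binary b @ 3 # vs"
    by (simp add: enc_number_def)
  have "3 \<notin> set (binary a)" "3 \<notin> set (binary b)"
    using binary_digits[of 3] by auto
  from terminated_inject[OF eq this] show "a = b \<and> us = vs"
    using binary_inject by blast
qed simp

lemma enc_number_not_4 [simp]: "enc_number a @ us \<noteq> 4 # vs"
  using binary_digits[of 4 a] by (cases "binary a") (auto simp: enc_number_def)

lemma not_4_enc_number [simp]: "4 # vs \<noteq> enc_number a @ us"
  using enc_number_not_4 by metis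

lemma enc_numbers_inject [simp]:
  "enc_numbers ms @ us = enc_numbers ns @ vs \<longleftrightarrow> ms = ns \<and> us = vs"
proof (induction ms arbitrary: ns)
  case Nil
  then show ?case by (cases ns) (auto simp: enc_numbers_def)
next
  case (Cons m ms)
  then show ?case by (cases ns) (auto simp: enc_numbers_def)
qed

lemma enc_votes_inject [simp]:
  "enc_votes U @ us = enc_votes V @ vs \<longleftrightarrow> U = V \<and> us = vs"
proof (induction U arbitrary: V)
  case Nil
  then show ?case by (cases V) (auto simp: enc_votes_def)
next
  case (Cons x U)
  note IH = Cons.IH
  obtain w v where x: "x = (w, v)" by force
  show ?case
  proof (cases V)
    case Nil
    then show ?thesis by (simp add: enc_votes_def x)
  next
    case (Cons y V')
    obtain w' v' where "y = (w', v')" by force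
    then show ?thesis using IH[of V'] Cons by (simp add: enc_votes_def x)
  qed
qed

lemma inj_encode: "inj encode"
proof (rule injI)
  fix I J :: cwcm
  assume "encode I = encode J"
  then have "encode I @ [] = encode J @ []" by (rule arg_cong)
  then show "I = J"
    unfolding encode_def append_assoc enc_number_inject enc_numbers_inject enc_votes_inject
    by simp
qed

end

theory Submission
  imports Defs
begin

text \<open>
  For both rules the manipulators may all cast the same vote: a complete one with \<open>p\<close> on top for
  plurality, the vote for \<open>p\<close> alone for veto. If there is a second candidate, it gives their
  whole weight to \<open>p\<close> and nothing to anyone else, which is clearly best. So \<open>p\<close> can win iff no
  candidate has more points from the given votes than \<open>p\<close> has together with the total weight of
  the manipulators.

  This test is carried out by a stack program whose only loop repeats its body \<open>n\<close> times, where \<open>n\<close> is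
  the length of the input. The running time of such a program is polynomial by its shape, whatever
  it computes, so only its correctness has to be proved. There \<open>n\<close> iterations always suffice since
  no stack that controls a loop is longer than \<open>n\<close>; in particular the sum of all weights is
  below \<open>2 ^ n\<close>.
\<close>

text \<open>Both rules have 0/1 vectors, so each vote gives a candidate either its weight or
  nothing; scoring means deciding one bit per vote and candidate and adding weights in binary.
  Rounding down acts in opposite ways: under plurality a vote helps its top candidate only if at
  most one candidate is unranked, under veto every ranked candidate of an incomplete vote gets the
  point. Hence the vote for \<open>p\<close> is complete for plurality and as short as possible for
  veto.

  The obstacle is that polynomial time refers to Turing machines. The loop bound \<open>n\<close>
  has to be available to the machine: it is kept in unary on counter stacks, one pair for each
  nesting level, which are filled while the input is read. The nesting depth is fixed by the
  program, so induction over its syntax gives the polynomial. Moreover the language contains only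
  encodings of valid instances, so malformed words and invalid instances have to be rejected too. A
  finite automaton checks the syntax, and counting occurrences checks distinctness and
  membership.\<close>

section \<open>Recognising encodings\<close>

text \<open>
  State \<open>3 * ph + pr\<close> means that section \<open>ph\<close> of the input is being read (0: preferred candidate,
  1: candidates, 2: weight or end of the votes, 3: ranking of a vote, 4: weights of the
  manipulators) and that the current number is empty (\<open>pr = 0\<close>) or ends in the symbol \<open>pr\<close>.
  State 15 accepts and state 16 is dead.
\<close>

definition after_number :: "nat \<Rightarrow> nat" where
  "after_number ph = (if ph = 0 then 1 else if ph = 2 then 3 else ph)"

definition after_list :: "nat \<Rightarrow> nat" where
  "after_list ph = (if ph = 0 then 16 else if ph = 1 \<or> ph = 3 then 6 else if ph = 2 then 12 else 15)"

definition delta :: "nat \<Rightarrow> nat \<Rightarrow> nat" where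
  "delta q x =
     (if 15 \<le> q then 16
      else if x = 1 \<or> x = 2 then 3 * (q div 3) + x
      else if x = 3 \<and> q mod 3 \<noteq> 1 then 3 * after_number (q div 3)
      else if x = 4 \<and> q mod 3 = 0 then after_list (q div 3)
      else 16)"

lemma delta_section:
  assumes "ph \<le> 4" "pr \<le> 2"
  shows "delta (3 * ph + pr) x =
     (if x = 1 \<or> x = 2 then 3 * ph + x
      else if x = 3 \<and> pr \<noteq> 1 then 3 * after_number ph
      else if x = 4 \<and> pr = 0 then after_list ph
      else 16)"
proof -
  have "(3 * ph + pr) div 3 = ph" "(3 * ph + pr) mod 3 = pr" "\<not> 15 \<le> 3 * ph + pr"
    using assms by auto
  then show ?thesis unfolding delta_def by simp
qed

text \<open>States of the automaton will be stored as stack symbols, and the final program uses 25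
  of these.\<close>

lemma delta_less: "delta q x < 25"
  by (auto simp: delta_def after_number_def after_list_def)

lemma delta_dead: "foldl delta 16 w = 16"
  by (induction w) (auto simp: delta_def)

lemma delta_accepted: "foldl delta 15 w = 15 \<longleftrightarrow> w = []"
  by (cases w) (auto simp: delta_def delta_dead)

text \<open>The digits already read enter only through \<open>pr\<close>, so the induction runs over
  the digits still to come. A nonzero number ends in the digit one, which is the symbol 2; zero has
  no digits and leaves the state alone.\<close>

lemma delta_binary:
  "ph \<le> 4 \<Longrightarrow> pr \<le> 2 \<Longrightarrow> foldl delta (3 * ph + pr) (binary k) = (if k = 0 then 3 * ph + pr else 3 * ph + 2)"
proof (induction k arbitrary: pr rule: binary.induct)
  case (1 k)
  show ?case
  proof (cases "k = 0")
    case True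
    then show ?thesis by (simp add: binary.simps)
  next
    case False
    have "k mod 2 < 2" by simp
    then have d: "delta (3 * ph + pr) (k mod 2 + 1) = 3 * ph + (k mod 2 + 1)" "k mod 2 + 1 \<le> 2"
      using "1.prems" by (auto simp: delta_def)
    have "foldl delta (3 * ph + pr) (binary k) = foldl delta (3 * ph + (k mod 2 + 1)) (binary (k div 2))"
      using False d(1) by (subst binary.simps) simp
    also have "\<dots> = (if k div 2 = 0 then 3 * ph + (k mod 2 + 1) else 3 * ph + 2)"
      using False "1.prems"(1) d(2) by (intro "1.IH") auto
    also have "\<dots> = 3 * ph + 2"
      using False by (cases "k = 1") auto
    finally show ?thesis using False by simp
  qed
qed

lemma delta_enc_number:
  assumes "ph \<le> 4"
  shows "foldl delta (3 * ph) (enc_number k @ w) = foldl delta (3 * after_number ph) w"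
proof -
  have "delta (3 * ph) 3 = 3 * after_number ph" "delta (3 * ph + 2) 3 = 3 * after_number ph"
    using assms delta_section[of ph 0 3] delta_section[of ph 2 3] by auto
  then show ?thesis using delta_binary[of ph 0 k] assms by (auto simp: enc_number_def)
qed

lemma delta_enc_numbers:
  assumes "ph \<in> {1, 3, 4}"
  shows "foldl delta (3 * ph) (enc_numbers ks @ w) = foldl delta (after_list ph) w"
proof (induction ks)
  case Nil
  have "delta (3 * ph) 4 = after_list ph" using assms by (auto simp: delta_def)
  then show ?case by (simp add: enc_numbers_def)
next
  case (Cons k ks)
  have "after_number ph = ph" "ph \<le> 4" using assms by (auto simp: after_number_def)
  then show ?case using Cons delta_enc_number[of ph k] by (simp add: enc_numbers_def)
qed

lemma delta_enc_votes: "foldl delta 6 (enc_votes V @ w) = foldl delta 12 w"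
proof (induction V)
  case Nil
  show ?case by (simp add: enc_votes_def delta_def after_list_def)
next
  case (Cons x V)
  obtain k v where x: "x = (k, v)" by (cases x)
  show ?case
    using Cons delta_enc_number[of 2 k] delta_enc_numbers[of 3 v]
    by (simp add: enc_votes_def x after_number_def after_list_def)
qed

lemma delta_encode: "foldl delta 0 (encode I) = 15"
  using delta_enc_number[of 0 "preferred I"] delta_enc_numbers[of 1 "candidates I"]
    delta_enc_votes[of "fixed_votes I"] delta_enc_numbers[of 4 "manipulator_weights I" "[]"]
  by (simp add: encode_def after_number_def after_list_def)

section \<open>Accepted words are encodings\<close>

lemma binary_double: "k \<noteq> 0 \<Longrightarrow> 1 # binary k = binary (2 * k)" "2 # binary k = binary (2 * k + 1)"
  by (subst (2) binary.simps, simp)+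

text \<open>Stated for a partly read number, with \<open>k\<close> formed by the remaining digits.
  If the digit just read was a zero, \<open>k\<close> must be nonzero because no number may end
  there; this is what turns a zero in front of \<open>binary k\<close> into
  \<open>binary (2 * k)\<close>.\<close>

lemma delta_cases:
  assumes "foldl delta (3 * ph + pr) w = 15" "ph \<le> 4" "pr \<le> 2"
  shows "(\<exists>k w'. w = binary k @ 3 # w' \<and> (k = 0 \<longrightarrow> pr \<noteq> 1) \<and> foldl delta (3 * after_number ph) w' = 15) \<or>
    pr = 0 \<and> (\<exists>w'. w = 4 # w' \<and> foldl delta (after_list ph) w' = 15)"
  using assms
proof (induction w arbitrary: pr)
  case (Cons x w)
  note next_state = delta_section[OF Cons.prems(2,3)]
  consider "x = 1" | "x = 2" | "x = 3" "pr \<noteq> 1" | "x = 4" "pr = 0" | "delta (3 * ph + pr) x = 16"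
    using next_state[of x] by (auto split: if_splits)
  then show ?case
  proof cases
    case 1
    then have "foldl delta (3 * ph + 1) w = 15"
      using Cons.prems(1) next_state[of x] by simp
    then obtain k w' where "w = binary k @ 3 # w'" "k \<noteq> 0" "foldl delta (3 * after_number ph) w' = 15"
      using Cons.IH[of 1] Cons.prems(2) by auto
    then show ?thesis using 1 binary_double(1)[of k]
      by (intro disjI1 exI[of _ "2 * k"] exI[of _ w']) (simp flip: append_Cons)
  next
    case 2
    then have "foldl delta (3 * ph + 2) w = 15"
      using Cons.prems(1) next_state[of x] by simp
    then obtain k w' where "w = binary k @ 3 # w'" "foldl delta (3 * after_number ph) w' = 15"
      using Cons.IH[of 2] Cons.prems(2) by auto
    then show ?thesis using 2 binary_double(2)[of k]
      by (intro disjI1 exI[of _ "2 * k + 1"] exI[of _ w']) (simp flip: append_Cons)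
  next
    case 3
    then have "foldl delta (3 * after_number ph) w = 15"
      using Cons.prems(1) next_state[of x] by simp
    then show ?thesis using 3 by (intro disjI1 exI[of _ 0] exI[of _ w]) (simp add: binary.simps)
  next
    case 4
    then have "foldl delta (after_list ph) w = 15"
      using Cons.prems(1) next_state[of x] by simp
    then show ?thesis using 4 by blast
  next
    case 5
    then show ?thesis using Cons.prems(1) by (simp add: delta_dead)
  qed
qed auto

lemma delta_number:
  assumes "foldl delta (3 * ph) w = 15" "ph \<le> 4"
  obtains k w' where "w = enc_number k @ w'" "foldl delta (3 * after_number ph) w' = 15"
  | w' where "w = 4 # w'" "foldl delta (after_list ph) w' = 15"
  using delta_cases[of ph 0 w] assms by (auto simp: enc_number_def)

lemma delta_numbers:
  assumes "foldl delta (3 * ph) w = 15" "ph \<in> {1, 3, 4}"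
  shows "\<exists>ks w'. w = enc_numbers ks @ w' \<and> foldl delta (after_list ph) w' = 15"
  using assms(1)
proof (induction w rule: length_induct)
  case (1 w)
  have ph: "ph \<le> 4" "after_number ph = ph" using assms(2) by (auto simp: after_number_def)
  from "1.prems" ph(1) show ?case
  proof (cases rule: delta_number)
    case (1 k w')
    then have "length w' < length w" by (simp add: enc_number_def)
    then obtain ks w'' where "w' = enc_numbers ks @ w''" "foldl delta (after_list ph) w'' = 15"
      using "1.IH" 1(2) ph(2) by auto
    then show ?thesis using 1(1) by (intro exI[of _ "k # ks"] exI[of _ w'']) (simp add: enc_numbers_def)
  next
    case (2 w')
    then show ?thesis by (intro exI[of _ "[]"] exI[of _ w']) (simp add: enc_numbers_def)
  qed
qed

lemma delta_votes:
  assumes "foldl delta 6 w = 15"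
  shows "\<exists>V w'. w = enc_votes V @ w' \<and> foldl delta 12 w' = 15"
  using assms
proof (induction w rule: length_induct)
  case (1 w)
  have "foldl delta (3 * 2) w = 15" "2 \<le> (4 :: nat)" using "1.prems" by simp_all
  then show ?case
  proof (cases rule: delta_number)
    case (1 k w1)
    then have "foldl delta (3 * 3) w1 = 15" by (simp add: after_number_def)
    then obtain v w2 where w2: "w1 = enc_numbers v @ w2" "foldl delta 6 w2 = 15"
      using delta_numbers[of 3 w1] by (auto simp: after_list_def)
    then have "length w2 < length w" using 1 by (simp add: enc_number_def)
    then obtain V w3 where "w2 = enc_votes V @ w3" "foldl delta 12 w3 = 15"
      using "1.IH" w2(2) by auto
    then show ?thesis using 1(1) w2(1)
      by (intro exI[of _ "(k, v) # V"] exI[of _ w3]) (simp add: enc_votes_def)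
  next
    case (2 w')
    then show ?thesis
      by (intro exI[of _ "[]"] exI[of _ w']) (simp add: enc_votes_def after_list_def)
  qed
qed

text \<open>Only the syntax is settled here: the record found may have repeated candidates or
  illegal votes. These are left to the stack program.\<close>

lemma delta_accepts_iff: "foldl delta 0 w = 15 \<longleftrightarrow> (\<exists>I. w = encode I)"
proof
  assume "foldl delta 0 w = 15"
  then have "foldl delta (3 * 0) w = 15" by simp
  then obtain p w1 where w1: "w = enc_number p @ w1" "foldl delta (3 * 1) w1 = 15"
    by (rule delta_number) (auto simp: after_number_def after_list_def delta_dead)
  obtain C w2 where w2: "w1 = enc_numbers C @ w2" "foldl delta 6 w2 = 15"
    using delta_numbers[OF w1(2)] by (auto simp: after_list_def)
  obtain V w3 where w3: "w2 = enc_votes V @ w3" "foldl delta (3 * 4) w3 = 15"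
    using delta_votes[OF w2(2)] by auto
  obtain W w4 where w4: "w3 = enc_numbers W @ w4" "foldl delta 15 w4 = 15"
    using delta_numbers[OF w3(2)] by (auto simp: after_list_def)
  then have "w = encode \<lparr>preferred = p, candidates = C, fixed_votes = V, manipulator_weights = W\<rparr>"
    using w1(1) w2(1) w3(1) by (simp add: delta_accepted encode_def)
  then show "\<exists>I. w = encode I" ..
qed (auto simp: delta_encode)

section \<open>Stack machines as Turing machines\<close>

text \<open>An empty stack shows the tape blank 0. Emptiness is tested this way, so stacks that are
  traversed must not contain 0.\<close>

fun peek :: "nat list \<Rightarrow> nat" where
  "peek [] = 0"
| "peek (x # xs) = x"

type_synonym store = "nat \<Rightarrow> nat list"

abbreviation tops :: "store \<Rightarrow> nat \<Rightarrow> nat" where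
  "tops s \<equiv> \<lambda>i. peek (s i)"

datatype instr =
    IPush nat "(nat \<Rightarrow> nat) \<Rightarrow> nat"
  | IPop nat
  | IJump "(nat \<Rightarrow> nat) \<Rightarrow> bool" nat

fun exec_instr :: "instr \<Rightarrow> nat \<times> store \<Rightarrow> nat \<times> store" where
  "exec_instr (IPush r g) (pc, s) = (pc + 1, s(r := g (tops s) # s r))"
| "exec_instr (IPop r) (pc, s) = (pc + 1, s(r := tl (s r)))"
| "exec_instr (IJump b a) (pc, s) = ((if b (tops s) then a else pc + 1), s)"

definition exec :: "instr list \<Rightarrow> nat \<times> store \<Rightarrow> nat \<times> store" where
  "exec code c = (if fst c < length code then exec_instr (code ! fst c) c else c)"

fun wf_instr :: "nat \<Rightarrow> nat \<Rightarrow> nat \<Rightarrow> instr \<Rightarrow> bool" where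
  "wf_instr K S N (IPush r g) \<longleftrightarrow> r < K \<and>
     (\<forall>h. (\<forall>i. h i < S) \<longrightarrow> g h < S) \<and> (\<forall>h x. g (h(r := x)) = g h)"
| "wf_instr K S N (IPop r) \<longleftrightarrow> r < K"
| "wf_instr K S N (IJump b a) \<longleftrightarrow> a \<le> N"

text \<open>The top of the stack is under the head and the rest to its right, followed by blanks.
  Nothing is required of \<open>l\<close>: a pop merely moves right and leaves the old symbol
  behind, and a later push overwrites it.\<close>

fun stack_on :: "tape \<Rightarrow> nat list \<Rightarrow> bool" where
  "stack_on (l, x, r) xs \<longleftrightarrow> (\<exists>k. x # r = xs @ replicate k 0)"

lemma stack_on_read: "stack_on t xs \<Longrightarrow> read_head t = peek xs"
proof (cases t; cases xs)
  fix l x r assume "stack_on t xs" "t = (l, x, r)" "xs = []"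
  then obtain k where "x # r = replicate k 0" by auto
  then show ?thesis using \<open>xs = []\<close> \<open>t = _\<close> by (cases k) auto
qed auto

lemma stack_on_pop: "stack_on t xs \<Longrightarrow> stack_on (move_head Right t) (tl xs)"
proof -
  assume a: "stack_on t xs"
  obtain l x r where t: "t = (l, x, r)" by (cases t) auto
  from a t obtain k where k: "x # r = xs @ replicate k 0" by auto
  have r: "\<exists>k. r = tl xs @ replicate k 0"
  proof (cases xs)
    case Nil
    with k show ?thesis by (cases k) auto
  qed (use k in auto)
  show ?thesis
  proof (cases r)
    case Nil
    with r have "tl xs = []" by simp
    then show ?thesis using Nil t by (auto intro: exI[of _ 1])
  qed (use r t in auto)
qed

lemma stack_on_push: "stack_on t xs \<Longrightarrow> stack_on (write_head a (move_head Left t)) (a # xs)"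
proof -
  assume a: "stack_on t xs"
  obtain l x r where t: "t = (l, x, r)" by (cases t) auto
  show ?thesis using a t by (cases l) auto
qed

declare stack_on.simps [simp del]

text \<open>
  Position \<open>pc\<close> of the code is state \<open>2 * pc\<close>. Pushing a symbol takes two steps, a move to the left
  and a write, and \<open>2 * pc + 1\<close> is the state in between; at that moment the pushed symbol is computed
  again, which is why it must not depend on the top of the stack that is being changed.
\<close>

definition keep :: "nat list \<Rightarrow> (nat \<times> dir) list" where
  "keep rs = map (\<lambda>x. (x, Stay)) rs"

definition tm_trans :: "nat \<Rightarrow> instr list \<Rightarrow> nat \<Rightarrow> nat list \<Rightarrow> nat \<times> (nat \<times> dir) list" where
  "tm_trans K code q rs =
     (let h = (\<lambda>i. if i < K then rs ! i else 0); pc = q div 2 in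
      if length code \<le> pc then (q, keep rs)
      else case code ! pc of
        IPush r g \<Rightarrow> if even q then (q + 1, (keep rs)[r := (rs ! r, Left)])
                     else (2 * (pc + 1), (keep rs)[r := (g h, Stay)])
      | IPop r \<Rightarrow> (2 * (pc + 1), (keep rs)[r := (rs ! r, Right)])
      | IJump b a \<Rightarrow> (if b h then 2 * a else 2 * (pc + 1), keep rs))"

text \<open>Running off the end of the code rejects, and a jump one position further accepts. This
  is why jump targets up to \<open>length code + 1\<close> are legal.\<close>

definition stack_tm :: "nat \<Rightarrow> nat \<Rightarrow> instr list \<Rightarrow> tm" where
  "stack_tm K S code =
     \<lparr>n_tapes = K, n_states = 2 * length code + 4, n_symbols = S, start = 0,
      accept = 2 * (length code + 1), reject = 2 * length code, trans = tm_trans K code\<rparr>"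

lemma stack_tm_sel [simp]:
  "n_tapes (stack_tm K S code) = K" "n_states (stack_tm K S code) = 2 * length code + 4"
  "n_symbols (stack_tm K S code) = S" "start (stack_tm K S code) = 0"
  "accept (stack_tm K S code) = 2 * (length code + 1)"
  "reject (stack_tm K S code) = 2 * length code" "trans (stack_tm K S code) = tm_trans K code"
  by (simp_all add: stack_tm_def)

lemma turing_machine_stack_tm:
  assumes "K \<ge> 1" "S \<ge> 1" and wf: "\<forall>c\<in>set code. wf_instr K S (length code + 1) c"
  shows "turing_machine (stack_tm K S code)"
proof -
  have keep_upd: "\<forall>(s, d)\<in>set ((keep rs)[r := (a, e)]). s < S"
    if "\<forall>x\<in>set rs. x < S" "a < S" for rs r a e
    using that set_update_subset_insert[of "keep rs" r "(a, e)"] by (fastforce simp: keep_def)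
  have main: "case tm_trans K code q rs of (q', acts) \<Rightarrow>
           q' < 2 * length code + 4 \<and> length acts = K \<and> (\<forall>(s, d)\<in>set acts. s < S)"
    if q: "q < 2 * length code + 4" and len: "length rs = K" and rs: "\<forall>x\<in>set rs. x < S" for q rs
  proof (cases "length code \<le> q div 2")
    case True
    then show ?thesis using q len rs by (auto simp: tm_trans_def keep_def)
  next
    case False
    then have mem: "code ! (q div 2) \<in> set code" by simp
    have h: "\<forall>i. (if i < K then rs ! i else 0) < S" using len rs assms(2) by auto
    show ?thesis
    proof (cases "code ! (q div 2)")
      case (IPush r g)
      have "r < K" "g (\<lambda>i. if i < K then rs ! i else 0) < S"
        using wf mem IPush h by fastforce+
      then show ?thesis
        using False IPush len keep_upd[OF rs, of "rs ! r"] keep_upd[OF rs, of "g _"] rs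
        by (auto simp: tm_trans_def keep_def[THEN arg_cong[of _ _ length]] Let_def)
    next
      case (IPop r)
      have "r < K" using wf mem IPop by fastforce
      then show ?thesis using False IPop len keep_upd[OF rs, of "rs ! r"] rs
        by (auto simp: tm_trans_def keep_def[THEN arg_cong[of _ _ length]] Let_def)
    next
      case (IJump b a)
      have "a \<le> length code + 1" using wf mem IJump by fastforce
      then show ?thesis using False IJump len rs
        by (auto simp: tm_trans_def keep_def Let_def)
    qed
  qed
  show ?thesis unfolding turing_machine_def using assms(1,2) main by simp
qed

text \<open>Emptiness of the stacks from \<open>K\<close> on makes \<open>tops s\<close> agree with
  the default 0 that \<open>tm_trans\<close> supplies where there is no tape.\<close>

definition represents :: "nat \<Rightarrow> tape list \<Rightarrow> store \<Rightarrow> bool" where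
  "represents K ts s \<longleftrightarrow>
     length ts = K \<and> (\<forall>i<K. stack_on (ts ! i) (s i)) \<and> (\<forall>i\<ge>K. s i = [])"

lemma write_read [simp]: "write_head (read_head t) t = t"
  by (cases t) auto

lemma map2_keep:
  "map2 (\<lambda>(s, d) t. move_head d (write_head s t)) (keep (map read_head ts)) ts = ts"
  by (rule nth_equalityI) (auto simp: keep_def)

lemma map2_keep_upd:
  "map2 (\<lambda>(s, d) t. move_head d (write_head s t)) ((keep (map read_head ts))[r := (a, d)]) ts =
     ts[r := move_head d (write_head a (ts ! r))]"
proof (rule nth_equalityI)
  fix i
  assume "i < length (map2 (\<lambda>(s, d) t. move_head d (write_head s t))
    ((keep (map read_head ts))[r := (a, d)]) ts)"
  then show "map2 (\<lambda>(s, d) t. move_head d (write_head s t))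
      ((keep (map read_head ts))[r := (a, d)]) ts ! i =
    ts[r := move_head d (write_head a (ts ! r))] ! i"
    by (cases "i = r") (auto simp: keep_def)
qed (simp add: keep_def)

lemma represents_upd:
  assumes "represents K ts s" "stack_on t xs" "r < K"
  shows "represents K (ts[r := t]) (s(r := xs))"
  using assms by (auto simp: represents_def nth_list_update)

lemma step_stack_tm:
  assumes rep: "represents K ts s" and pc: "pc < length code"
    and wf: "wf_instr K S N (code ! pc)" and e: "exec code (pc, s) = (pc', s')"
  shows "\<exists>k ts'. k \<le> 2 \<and> (step (stack_tm K S code) ^^ k) (2 * pc, ts) = (2 * pc', ts') \<and>
           represents K ts' s'"
proof -
  let ?M = "stack_tm K S code"
  have h: "(\<lambda>i. if i < K then map read_head ts ! i else 0) = tops s"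
    using rep by (auto simp: represents_def fun_eq_iff stack_on_read)
  have len: "length ts = K" using rep by (simp add: represents_def)
  show ?thesis
  proof (cases "code ! pc")
    case (IPush r g)
    then have r: "r < K" and indep: "\<And>h x. g (h(r := x)) = g h" using wf by auto
    let ?ts1 = "ts[r := move_head Left (ts ! r)]"
    have rd: "read_head (ts ! r) = map read_head ts ! r" using r len by simp
    have 1: "step ?M (2 * pc, ts) = (2 * pc + 1, ?ts1)"
      using pc IPush r len
      by (auto simp: tm_trans_def Let_def map2_keep_upd simp flip: rd)
    let ?h = "\<lambda>i. if i < K then map read_head ?ts1 ! i else 0"
    \<comment> \<open>After the move to the left, tape \<open>r\<close> shows some left-over symbol.
      All other tapes read as before, so \<open>g\<close> still yields the symbol meant at the start
      of the push.\<close>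
    have "?h = (\<lambda>i. if i < K then map read_head ts ! i else 0)(r := ?h r)"
      using len by (auto simp: fun_eq_iff nth_list_update)
    then have g: "g ?h = g (tops s)" using indep h by metis
    have 2: "step ?M (2 * pc + 1, ?ts1) =
        (2 * (pc + 1), ?ts1[r := write_head (g (tops s)) (?ts1 ! r)])"
    proof -
      have "tm_trans K code (2 * pc + 1) (map read_head ?ts1) =
          (2 * (pc + 1), (keep (map read_head ?ts1))[r := (g (tops s), Stay)])"
        using pc IPush g by (simp add: tm_trans_def Let_def)
      \<comment> \<open>The state in the middle of a push is odd and both halting states are even,
        so the machine cannot stop there.\<close>
      moreover have "2 * pc + 1 \<noteq> 2 * length code" "2 * pc + 1 \<noteq> 2 * (length code + 1)"
        by presburger+
      ultimately show ?thesis by (simp add: map2_keep_upd del: map_update)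
    qed
    have "stack_on (write_head (g (tops s)) (move_head Left (ts ! r))) (g (tops s) # s r)"
      using rep r by (simp add: represents_def stack_on_push)
    from represents_upd[OF rep this r]
    have "represents K (?ts1[r := write_head (g (tops s)) (?ts1 ! r)]) s'"
      using e pc IPush r len by (auto simp: exec_def)
    then show ?thesis using 1 2 e pc IPush
      by (intro exI[of _ 2] exI conjI) (auto simp: exec_def numeral_2_eq_2)
  next
    case (IPop r)
    then have r: "r < K" using wf by auto
    have rd: "read_head (ts ! r) = map read_head ts ! r" using r len by simp
    have 1: "step ?M (2 * pc, ts) = (2 * (pc + 1), ts[r := move_head Right (ts ! r)])"
      using pc IPop r len
      by (auto simp: tm_trans_def Let_def map2_keep_upd simp flip: rd)
    have "stack_on (move_head Right (ts ! r)) (tl (s r))"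
      using rep r by (simp add: represents_def stack_on_pop)
    from represents_upd[OF rep this r]
    have "represents K (ts[r := move_head Right (ts ! r)]) s'"
      using e pc IPop r len by (auto simp: exec_def)
    then show ?thesis using 1 e pc IPop
      by (intro exI[of _ 1] exI conjI) (auto simp: exec_def)
  next
    case (IJump b a)
    have 1: "step ?M (2 * pc, ts) = (2 * pc', ts)"
      using pc IJump e
      by (auto simp: tm_trans_def Let_def map2_keep h exec_def)
    then show ?thesis using rep e pc IJump
      by (intro exI[of _ 1] exI conjI) (auto simp: exec_def)
  qed
qed

lemma steps_stack_tm:
  assumes "represents K ts s" and wf: "\<forall>c\<in>set code. wf_instr K S N c"
    and "(exec code ^^ t) (pc, s) = (pc', s')"
  shows "\<exists>k ts'. k \<le> 2 * t \<and> (step (stack_tm K S code) ^^ k) (2 * pc, ts) = (2 * pc', ts') \<and>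
           represents K ts' s'"
  using assms(1,3)
proof (induction t arbitrary: pc s ts)
  case 0
  then show ?case by (intro exI[of _ 0]) auto
next
  case (Suc t)
  obtain pc1 s1 where e: "exec code (pc, s) = (pc1, s1)" by fastforce
  have rest: "(exec code ^^ t) (pc1, s1) = (pc', s')"
    using Suc.prems(2) e by (simp add: funpow_swap1)
  have "\<exists>k ts'. k \<le> 2 \<and> (step (stack_tm K S code) ^^ k) (2 * pc, ts) = (2 * pc1, ts') \<and>
           represents K ts' s1"
  proof (cases "pc < length code")
    case True
    then show ?thesis using step_stack_tm[OF Suc.prems(1) True _ e] wf nth_mem[OF True] by blast
  next
    case False
    then show ?thesis using e Suc.prems(1) by (intro exI[of _ 0]) (auto simp: exec_def)
  qed
  then obtain k ts1 where k: "k \<le> 2" "represents K ts1 s1"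
    "(step (stack_tm K S code) ^^ k) (2 * pc, ts) = (2 * pc1, ts1)" by blast
  obtain k' ts2 where k': "k' \<le> 2 * t" "represents K ts2 s'"
    "(step (stack_tm K S code) ^^ k') (2 * pc1, ts1) = (2 * pc', ts2)"
    using Suc.IH[OF k(2) rest] by blast
  show ?case using k k'
    by (intro exI[of _ "k' + k"] exI[of _ ts2]) (simp add: funpow_add)
qed

definition stores_input :: "nat list \<Rightarrow> store" where
  "stores_input w = (\<lambda>_. [])(0 := w)"

lemma represents_initial:
  assumes "K \<ge> 1"
  shows "\<exists>ts. initial (stack_tm K S code) w = (0, ts) \<and> represents K ts (stores_input w)"
proof -
  have e: "stack_on ([], 0, []) []" by (auto simp: stack_on.simps intro: exI[of _ 1])
  have "stack_on (input_tape w) w"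
    by (cases w) (auto simp: stack_on.simps intro: exI[of _ 1] exI[of _ 0])
  then have "represents K (input_tape w # replicate (K - 1) (input_tape [])) (stores_input w)"
    using assms e by (auto simp: represents_def stores_input_def nth_Cons')
  then show ?thesis by (simp add: initial_def)
qed

section \<open>Polynomial-time stack programs\<close>

datatype prog =
    Skip
  | Push nat "(nat \<Rightarrow> nat) \<Rightarrow> nat"
  | Pop nat
  | Seq prog prog (infixr ";;" 60)
  | Cond "(nat \<Rightarrow> nat) \<Rightarrow> bool" prog prog
  | Repeat prog

fun run :: "nat \<Rightarrow> prog \<Rightarrow> store \<Rightarrow> store" where
  "run n Skip s = s"
| "run n (Push r g) s = s(r := g (tops s) # s r)"
| "run n (Pop r) s = s(r := tl (s r))"
| "run n (p ;; q) s = run n q (run n p s)"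
| "run n (Cond b p q) s = (if b (tops s) then run n p s else run n q s)"
| "run n (Repeat p) s = (run n p ^^ n) s"

text \<open>Pushed symbols and conditions may read only stacks below \<open>R\<close>, since the
  stacks from there on will hold the loop counters. Independence of the pushed stack itself is what
  the two-step push requires.\<close>

fun wf_prog :: "nat \<Rightarrow> nat \<Rightarrow> prog \<Rightarrow> bool" where
  "wf_prog R S Skip \<longleftrightarrow> True"
| "wf_prog R S (Push r g) \<longleftrightarrow> r < R \<and> (\<forall>h. (\<forall>i. h i < S) \<longrightarrow> g h < S) \<and>
     (\<forall>h h'. (\<forall>i<R. i \<noteq> r \<longrightarrow> h i = h' i) \<longrightarrow> g h = g h')"
| "wf_prog R S (Pop r) \<longleftrightarrow> r < R"
| "wf_prog R S (p ;; q) \<longleftrightarrow> wf_prog R S p \<and> wf_prog R S q"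
| "wf_prog R S (Cond b p q) \<longleftrightarrow> (\<forall>h h'. (\<forall>i<R. h i = h' i) \<longrightarrow> b h = b h') \<and>
     wf_prog R S p \<and> wf_prog R S q"
| "wf_prog R S (Repeat p) \<longleftrightarrow> wf_prog R S p"

text \<open>The nesting depth of loops. Loops of equal level are never active at the same time and
  can share their counters, so the depth bounds the number of counters.\<close>

fun level :: "prog \<Rightarrow> nat" where
  "level (p ;; q) = max (level p) (level q)"
| "level (Cond b p q) = max (level p) (level q)"
| "level (Repeat p) = Suc (level p)"
| "level _ = 0"

fun csize :: "prog \<Rightarrow> nat" where
  "csize Skip = 0"
| "csize (Push r g) = 1"
| "csize (Pop r) = 1"
| "csize (p ;; q) = csize p + csize q"
| "csize (Cond b p q) = csize p + csize q + 2"
| "csize (Repeat p) = csize p + 8"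

text \<open>
  Stack \<open>R + 2 * level p\<close> counts the iterations of \<open>Repeat p\<close> that are left, in unary, and the stack
  after it those that are done. The latter restores the former in the end.
\<close>

fun compile :: "nat \<Rightarrow> prog \<Rightarrow> nat \<Rightarrow> instr list" where
  "compile R Skip a = []"
| "compile R (Push r g) a = [IPush r g]"
| "compile R (Pop r) a = [IPop r]"
| "compile R (p ;; q) a = compile R p a @ compile R q (a + csize p)"
| "compile R (Cond b p q) a =
     IJump (\<lambda>h. \<not> b h) (a + csize p + 2) # compile R p (a + 1) @
     IJump (\<lambda>_. True) (a + csize p + csize q + 2) # compile R q (a + csize p + 2)"
| "compile R (Repeat p) a =
     (let i = R + 2 * level p; c = csize p in
      [IJump (\<lambda>h. h i = 0) (a + c + 4), IPop i, IPush (i + 1) (\<lambda>_. 1)] @ compile R p (a + 3) @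
      [IJump (\<lambda>_. True) a,
       IJump (\<lambda>h. h (i + 1) = 0) (a + c + 8), IPop (i + 1), IPush i (\<lambda>_. 1),
       IJump (\<lambda>_. True) (a + c + 4)])"

lemma length_compile [simp]: "length (compile R p a) = csize p"
  by (induction p arbitrary: a) (auto simp: Let_def)

lemma wf_compile:
  assumes "wf_prog R S p" "1 < S" "a + csize p \<le> N" "R + 2 * level p \<le> K" "c \<in> set (compile R p a)"
  shows "wf_instr K S N c"
  using assms
proof (induction p arbitrary: a)
  case (Push r g)
  have "g (h(r := x)) = g h" for h x
    using Push.prems(1) by simp
  then show ?case using Push by simp
next
  case (Seq p q)
  then show ?case by (force simp: max_def split: if_splits)
next
  case (Cond b p q)
  have "2 * level p \<le> 2 * level (Cond b p q)" "2 * level q \<le> 2 * level (Cond b p q)" by auto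
  then have "R + 2 * level p \<le> K" "R + 2 * level q \<le> K" using Cond.prems(4) by linarith+
  then show ?case using Cond.prems Cond.IH(1)[of "a + 1"] Cond.IH(2)[of "a + csize p + 2"]
    by auto
next
  case (Repeat p)
  then show ?case using Repeat.IH[of "a + 3"] by (auto simp: Let_def)
qed auto

text \<open>A program neither reads nor writes the stacks from \<open>R\<close> on. This allows a
  compiled loop to change its counters around each run of its body.\<close>

lemma run_frame:
  assumes "wf_prog R S p" "R \<le> i"
  shows "run n p (s(i := x)) = (run n p s)(i := x)"
  using assms(1)
proof (induction p arbitrary: s)
  case (Push r g)
  have "g (tops (s(i := x))) = g (tops s)"
    using Push assms(2) by simp
  then show ?case using Push assms(2) by (auto simp: fun_upd_twist)
next
  case (Cond b p q)
  have "b (tops (s(i := x))) = b (tops s)"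
    using Cond.prems assms(2) by simp
  then show ?case using Cond by auto
next
  case (Repeat p)
  have "(run n p ^^ m) (s(i := x)) = ((run n p ^^ m) s)(i := x)" for m
    by (induction m) (use Repeat in auto)
  then show ?case by (simp del: fun_upd_apply)
qed (use assms(2) in \<open>auto simp: fun_upd_twist\<close>)

lemma run_other: "wf_prog R S p \<Longrightarrow> R \<le> i \<Longrightarrow> run n p s i = s i"
  using run_frame[of R S p i n s "s i"] by (metis fun_upd_same fun_upd_triv)

lemma funpow_run_frame:
  "wf_prog R S p \<Longrightarrow> R \<le> i \<Longrightarrow> (run n p ^^ m) (s(i := x)) = ((run n p ^^ m) s)(i := x)"
  by (induction m) (auto simp: run_frame)

text \<open>An iteration adds four instructions to the body (test, pop, push, jump), and so does the
  restoring of one unit of the counter; each phase ends with one more test. Adding up both branches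
  of a conditional instead of taking the maximum keeps the bound a polynomial.\<close>

fun cost :: "nat \<Rightarrow> prog \<Rightarrow> nat" where
  "cost n Skip = 0"
| "cost n (Push r g) = 1"
| "cost n (Pop r) = 1"
| "cost n (p ;; q) = cost n p + cost n q"
| "cost n (Cond b p q) = cost n p + cost n q + 2"
| "cost n (Repeat p) = n * (cost n p + 4) + 1 + (n * 4 + 1)"

lemma cost_poly: "\<exists>q. \<forall>n. cost n p \<le> poly q n"
proof (induction p)
  case (Seq p1 p2)
  then obtain q1 q2 where "\<forall>n. cost n p1 \<le> poly q1 n" "\<forall>n. cost n p2 \<le> poly q2 n" by blast
  then show ?case by (intro exI[of _ "q1 + q2"]) (simp add: add_mono)
next
  case (Cond b p1 p2)
  then obtain q1 q2 where "\<forall>n. cost n p1 \<le> poly q1 n" "\<forall>n. cost n p2 \<le> poly q2 n" by blast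
  then show ?case by (intro exI[of _ "q1 + q2 + [:2:]"]) (simp add: add_mono)
next
  case (Repeat p)
  then obtain q where "\<forall>n. cost n p \<le> poly q n" by blast
  \<comment> \<open>The witness is \<open>n * (q + 8) + 2\<close>, obtained by collecting the two
    phases of a compiled loop.\<close>
  then show ?case
    by (intro exI[of _ "[:0, 1:] * (q + [:8:]) + [:2:]"]) (auto simp: algebra_simps)
qed (auto intro: exI[of _ "[:1:]"])

section \<open>Correctness and running time of compiled code\<close>

definition reaches :: "instr list \<Rightarrow> nat \<Rightarrow> nat \<times> store \<Rightarrow> nat \<times> store \<Rightarrow> bool" where
  "reaches code t c c' \<longleftrightarrow> (\<exists>k\<le>t. (exec code ^^ k) c = c')"

lemma reaches_refl: "reaches code t c c"
  by (auto simp: reaches_def intro: exI[of _ 0])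

lemma reaches_trans:
  assumes "reaches code t c c'" "reaches code t' c' c''" "t + t' \<le> T"
  shows "reaches code T c c''"
proof -
  obtain k k' where "k \<le> t" "(exec code ^^ k) c = c'" "k' \<le> t'" "(exec code ^^ k') c' = c''"
    using assms by (auto simp: reaches_def)
  then show ?thesis using assms(3) unfolding reaches_def
    by (intro exI[of _ "k' + k"]) (simp add: funpow_add)
qed

lemma reaches_mono: "reaches code t c c' \<Longrightarrow> t \<le> T \<Longrightarrow> reaches code T c c'"
  using reaches_trans reaches_refl by (metis add.right_neutral le_add1 le_zero_eq)

lemma reaches_step:
  assumes "pc < length code" "reaches code t (exec_instr (code ! pc) (pc, s)) c"
  shows "reaches code (Suc t) (pc, s) c"
proof (rule reaches_trans[of _ 1])
  show "reaches code 1 (pc, s) (exec_instr (code ! pc) (pc, s))"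
    using assms(1) unfolding reaches_def by (intro exI[of _ 1]) (simp add: exec_def)
qed (use assms in auto)

lemma reaches_one:
  "pc < length code \<Longrightarrow> exec_instr (code ! pc) (pc, s) = c \<Longrightarrow> reaches code (Suc 0) (pc, s) c"
  using reaches_step reaches_refl by blast

lemma reaches_Suc: "reaches code 1 c c' \<Longrightarrow> reaches code t c' c'' \<Longrightarrow> reaches code (Suc t) c c''"
  by (rule reaches_trans) auto

definition code_at :: "instr list \<Rightarrow> nat \<Rightarrow> instr list \<Rightarrow> bool" where
  "code_at code a cs \<longleftrightarrow> (\<forall>i<length cs. a + i < length code \<and> code ! (a + i) = cs ! i)"

lemma code_at_Nil [simp]: "code_at code a []"
  by (simp add: code_at_def)

lemma code_at_Cons [simp]:
  "code_at code a (c # cs) \<longleftrightarrow> a < length code \<and> code ! a = c \<and> code_at code (Suc a) cs"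
  by (auto simp: code_at_def nth_Cons' less_Suc_eq_0_disj)

lemma code_at_append [simp]:
  "code_at code a (cs @ ds) \<longleftrightarrow> code_at code a cs \<and> code_at code (a + length cs) ds"
  by (induction cs arbitrary: a) auto

text \<open>The hypothesis on the counters is an invariant. The final store is
  \<open>run n p s\<close>, which agrees with \<open>s\<close> on all stacks from \<open>R\<close>
  on, so the next piece of code and the next round of an enclosing loop find the counters full
  again.\<close>

lemma reaches_compile:
  assumes "wf_prog R S p" "code_at code a (compile R p a)"
    and "\<forall>j<level p. s (R + 2 * j) = replicate n 1 \<and> s (R + 2 * j + 1) = []"
  shows "reaches code (cost n p) (a, s) (a + csize p, run n p s)"
  using assms
proof (induction p arbitrary: a s)
  case Skip
  then show ?case by (simp add: reaches_refl)
next
  case (Push r g)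
  then show ?case by (auto intro: reaches_one simp del: fun_upd_apply)
next
  case (Pop r)
  then show ?case by (auto intro: reaches_one simp del: fun_upd_apply)
next
  case (Seq p q)
  have "reaches code (cost n p) (a, s) (a + csize p, run n p s)"
    using Seq.prems by (intro Seq.IH) auto
  moreover have "reaches code (cost n q) (a + csize p, run n p s)
      (a + csize p + csize q, run n q (run n p s))"
    using Seq.prems by (intro Seq.IH) (auto simp: run_other)
  ultimately show ?case
    using reaches_trans by (simp add: add.assoc)
next
  case (Cond b p q)
  show ?case
  proof (cases "b (tops s)")
    case True
    have "reaches code (cost n p) (a + 1, s) (a + 1 + csize p, run n p s)"
      using Cond.prems by (intro Cond.IH) auto
    moreover have "reaches code 1 (a + 1 + csize p, run n p s)
        (a + csize (Cond b p q), run n p s)"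
      using Cond.prems by (auto intro!: reaches_step reaches_refl simp: add_ac)
    ultimately have "reaches code (cost n p + 1) (a + 1, s) (a + csize (Cond b p q), run n p s)"
      using reaches_trans by blast
    then have "reaches code (Suc (cost n p + 1)) (a, s) (a + csize (Cond b p q), run n p s)"
      using Cond.prems True by (intro reaches_step) auto
    then show ?thesis using True by (auto elim: reaches_mono)
  next
    case False
    have "reaches code (cost n q) (a + csize p + 2, s) (a + csize p + 2 + csize q, run n q s)"
      using Cond.prems by (intro Cond.IH) (auto simp: add_ac)
    then have "reaches code (Suc (cost n q)) (a, s) (a + csize p + 2 + csize q, run n q s)"
      using Cond.prems False by (intro reaches_step) auto
    then show ?thesis using False by (auto elim: reaches_mono simp: add_ac)
  qed
next
  case (Repeat p)
  define i where "i = R + 2 * level p"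
  define c where "c = csize p"
  have code: "code_at code a ([IJump (\<lambda>h. h i = 0) (a + c + 4), IPop i, IPush (i + 1) (\<lambda>_. 1)])"
    "code_at code (a + 3) (compile R p (a + 3))"
    "code_at code (a + c + 3) [IJump (\<lambda>_. True) a]"
    "code_at code (a + c + 4) [IJump (\<lambda>h. h (i + 1) = 0) (a + c + 8), IPop (i + 1),
        IPush i (\<lambda>_. 1), IJump (\<lambda>_. True) (a + c + 4)]"
    using Repeat.prems(2) by (simp_all add: Let_def i_def c_def add_ac numeral_eq_Suc)
  have wf: "wf_prog R S p" using Repeat.prems by simp
  have iR: "R \<le> i" "R \<le> Suc i" by (simp_all add: i_def)
  \<comment> \<open>Generalised to \<open>m\<close> iterations left and \<open>k\<close> done; it is
    applied with \<open>m = n\<close> and \<open>k = 0\<close>. The body runs with the counters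
    already updated, and \<open>run_frame\<close> moves these updates out of it.\<close>
  have loop1: "reaches code (m * (cost n p + 4) + 1) (a, s)
      (a + c + 4, ((run n p ^^ m) s)(i := [], i + 1 := replicate (k + m) 1))"
    if "s i = replicate m 1" "s (i + 1) = replicate k 1"
      "\<forall>j<level p. s (R + 2 * j) = replicate n 1 \<and> s (R + 2 * j + 1) = []" for m k s
    using that
  proof (induction m arbitrary: k s)
    case 0
    then have "s(i := [], i + 1 := replicate k 1) = s" by (auto simp: fun_eq_iff)
    then show ?case using 0 code(1) by (auto intro: reaches_one simp del: fun_upd_apply)
  next
    case (Suc m)
    let ?s = "s(i := replicate m 1, i + 1 := replicate (Suc k) 1)"
    let ?s' = "(run n p s)(i := replicate m 1, i + 1 := replicate (Suc k) 1)"
    have "reaches code (cost n p) (a + 3, ?s) (a + 3 + c, run n p ?s)"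
      unfolding c_def using Suc.prems wf code(2) by (intro Repeat.IH) (auto simp: i_def)
    moreover have "run n p ?s = ?s'"
      using iR by (simp add: run_frame[OF wf])
    moreover have "reaches code 1 (a + 3 + c, ?s') (a, ?s')"
      using code(3) by (auto intro!: reaches_step reaches_refl simp: add_ac)
    ultimately have "reaches code (cost n p + 1) (a + 3, ?s) (a, ?s')"
      using reaches_trans by auto
    moreover have "reaches code (m * (cost n p + 4) + 1) (a, ?s')
      (a + c + 4, ((run n p ^^ m) ?s')(i := [], i + 1 := replicate (Suc k + m) 1))"
      using Suc.prems run_other[OF wf] by (intro Suc.IH) (auto simp: i_def)
    moreover have "((run n p ^^ m) ?s')(i := [], i + 1 := replicate (Suc k + m) 1) =
      ((run n p ^^ Suc m) s)(i := [], i + 1 := replicate (k + Suc m) 1)"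
      using iR by (simp add: funpow_run_frame[OF wf] fun_upd_twist funpow_swap1)
    ultimately have body: "reaches code ((cost n p + 1) + (m * (cost n p + 4) + 1)) (a + 3, ?s)
      (a + c + 4, ((run n p ^^ Suc m) s)(i := [], i + 1 := replicate (k + Suc m) 1))"
      using reaches_trans by fastforce
    have "reaches code 1 (a, s) (a + 1, s)"
      using code(1) Suc.prems by (auto intro: reaches_one)
    moreover have "reaches code 1 (a + 1, s) (a + 2, s(i := replicate m 1))"
      using code(1) Suc.prems by (auto intro: reaches_one simp del: fun_upd_apply)
    moreover have "reaches code 1 (a + 2, s(i := replicate m 1)) (a + 3, ?s)"
      using code(1) Suc.prems by (auto intro!: reaches_one simp: numeral_eq_Suc fun_eq_iff)
    ultimately have "reaches code (Suc (Suc (Suc ((cost n p + 1) + (m * (cost n p + 4) + 1))))) (a, s)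
      (a + c + 4, ((run n p ^^ Suc m) s)(i := [], i + 1 := replicate (k + Suc m) 1))"
      using body by (blast intro: reaches_Suc)
    then show ?case by (rule reaches_mono) simp
  qed
  \<comment> \<open>The unary count of finished iterations is moved back, so that an enclosing loop
    can start this one anew.\<close>
  have loop2: "reaches code (m * 4 + 1) (a + c + 4, s)
      (a + c + 8, s(i := replicate (k + m) 1, i + 1 := []))"
    if "s i = replicate k 1" "s (i + 1) = replicate m 1" for m k s
    using that
  proof (induction m arbitrary: k s)
    case 0
    then have "s(i := replicate k 1, i + 1 := []) = s" by (auto simp: fun_eq_iff)
    then show ?case using 0 code(4) by (auto intro: reaches_one simp del: fun_upd_apply)
  next
    case (Suc m)
    let ?s = "s(i + 1 := replicate m 1, i := replicate (Suc k) 1)"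
    have "reaches code (m * 4 + 1) (a + c + 4, ?s)
        (a + c + 8, ?s(i := replicate (Suc k + m) 1, i + 1 := []))"
      by (intro Suc.IH) auto
    moreover have "?s(i := replicate (Suc k + m) 1, i + 1 := []) =
        s(i := replicate (k + Suc m) 1, i + 1 := [])"
      by (auto simp: fun_eq_iff)
    ultimately have rest: "reaches code (m * 4 + 1) (a + c + 4, ?s)
        (a + c + 8, s(i := replicate (k + Suc m) 1, i + 1 := []))"
      by simp
    have "reaches code 1 (a + c + 4, s) (a + c + 5, s)"
      using code(4) Suc.prems by (auto intro: reaches_one simp: numeral_eq_Suc)
    moreover have "reaches code 1 (a + c + 5, s) (a + c + 6, s(i + 1 := replicate m 1))"
      using code(4) Suc.prems
      by (auto intro!: reaches_one simp: numeral_eq_Suc simp del: fun_upd_apply)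
    moreover have "reaches code 1 (a + c + 6, s(i + 1 := replicate m 1)) (a + c + 7, ?s)"
      using code(4) Suc.prems by (auto intro!: reaches_one simp: numeral_eq_Suc fun_eq_iff)
    moreover have "reaches code 1 (a + c + 7, ?s) (a + c + 4, ?s)"
      using code(4) Suc.prems by (auto intro!: reaches_one simp: numeral_eq_Suc)
    ultimately have "reaches code (Suc (Suc (Suc (Suc (m * 4 + 1))))) (a + c + 4, s)
        (a + c + 8, s(i := replicate (k + Suc m) 1, i + 1 := []))"
      using rest by (blast intro: reaches_Suc)
    then show ?case by (rule reaches_mono) simp
  qed
  have s: "s i = replicate n 1" "s (i + 1) = []"
    using Repeat.prems(3) by (auto simp: i_def)
  let ?s = "((run n p ^^ n) s)(i := [], i + 1 := replicate n 1)"
  have "reaches code (n * (cost n p + 4) + 1) (a, s) (a + c + 4, ?s)"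
    using loop1[of s n 0] s Repeat.prems(3) by auto
  moreover have "reaches code (n * 4 + 1) (a + c + 4, ?s)
      (a + c + 8, ?s(i := replicate n 1, i + 1 := []))"
    using loop2[of ?s 0 n] by simp
  moreover have "?s(i := replicate n 1, i + 1 := []) = run n (Repeat p) s"
  proof -
    have "run n (Repeat p) s j = s j" if "R \<le> j" for j
      using Repeat.prems(1) that by (rule run_other)
    then show ?thesis using s iR by (auto simp: fun_eq_iff)
  qed
  ultimately have "reaches code (n * (cost n p + 4) + 1 + (n * 4 + 1)) (a, s)
      (a + c + 8, run n (Repeat p) s)"
    using reaches_trans by fastforce
  then show ?case by (simp add: c_def add_ac)
qed

text \<open>The input arrives reversed on stack 1.\<close>

definition whole_code :: "nat \<Rightarrow> nat \<Rightarrow> prog \<Rightarrow> instr list" where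
  "whole_code R out p =
     (let D = level p in
      [IJump (\<lambda>h. h 0 = 0) (D + 4), IPush 1 (\<lambda>h. h 0)] @
      map (\<lambda>j. IPush (R + 2 * j) (\<lambda>_. 1)) [0..<D] @ [IPop 0, IJump (\<lambda>_. True) 0] @
      compile R p (D + 4) @ [IJump (\<lambda>h. h out = 1) (D + csize p + 6)])"

lemma length_whole_code: "length (whole_code R out p) = level p + csize p + 5"
  by (simp add: whole_code_def Let_def)

text \<open>The store during loading, with \<open>v\<close> still unread and \<open>u\<close> the
  reverse of what has been read. Each counter has received one 1 per symbol read and thus ends up at
  the length of the input.\<close>

definition loaded :: "nat \<Rightarrow> nat \<Rightarrow> nat list \<Rightarrow> nat list \<Rightarrow> store" where
  "loaded R D u v = (\<lambda>i. if i = 0 then v else if i = 1 then u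
     else if i \<in> (\<lambda>j. R + 2 * j) ` {..<D} then replicate (length u) 1 else [])"

lemma reaches_pushes:
  assumes "code_at code a (map (\<lambda>j. IPush (R + 2 * j) (\<lambda>_. 1)) [0..<d])"
  shows "reaches code d (a, s)
    (a + d, \<lambda>i. if i \<in> (\<lambda>j. R + 2 * j) ` {..<d} then 1 # s i else s i)"
  using assms
proof (induction d)
  case 0
  then show ?case by (simp add: reaches_refl)
next
  case (Suc d)
  let ?s = "\<lambda>i. if i \<in> (\<lambda>j. R + 2 * j) ` {..<d} then 1 # s i else s i"
  have "reaches code d (a, s) (a + d, ?s)"
    using Suc by simp
  moreover have "reaches code 1 (a + d, ?s) (a + d + 1, ?s(R + 2 * d := 1 # ?s (R + 2 * d)))"
    using Suc.prems by (auto intro!: reaches_step reaches_refl)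
  moreover have "?s(R + 2 * d := 1 # ?s (R + 2 * d)) =
      (\<lambda>i. if i \<in> (\<lambda>j. R + 2 * j) ` {..<Suc d} then 1 # s i else s i)"
    by (auto simp: fun_eq_iff lessThan_Suc)
  ultimately show ?case using reaches_trans by fastforce
qed

text \<open>One symbol costs \<open>level p + 4\<close> instructions: a test, a push, one push for
  each counter, a pop and a jump. The end of the input is recognised by the blank, hence
  \<open>0 \<notin> set v\<close>; \<open>2 \<le> R\<close> keeps the counters apart from stacks 0
  and 1.\<close>

lemma reaches_load:
  assumes c: "code_at code 0 (whole_code R out p)" and R: "2 \<le> R" and v: "0 \<notin> set v"
  shows "reaches code ((level p + 4) * length v + 1) (0, loaded R (level p) u v)
    (level p + 4, loaded R (level p) (rev v @ u) [])"
  using v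
proof (induction v arbitrary: u)
  case Nil
  then show ?case using c
    by (auto intro!: reaches_step reaches_refl simp: whole_code_def Let_def loaded_def)
next
  case (Cons x v)
  let ?D = "level p"
  let ?J = "(\<lambda>j. R + 2 * j) ` {..<?D}"
  let ?s0 = "loaded R ?D u (x # v)"
  let ?s1 = "?s0(1 := x # u)"
  let ?s2 = "\<lambda>i. if i \<in> ?J then 1 # ?s1 i else ?s1 i"
  have code: "code_at code 0 [IJump (\<lambda>h. h 0 = 0) (?D + 4), IPush 1 (\<lambda>h. h 0)]"
    "code_at code 2 (map (\<lambda>j. IPush (R + 2 * j) (\<lambda>_. 1)) [0..<?D])"
    "code_at code (2 + ?D) [IPop 0, IJump (\<lambda>_. True) 0]"
    using c by (simp_all add: whole_code_def Let_def numeral_eq_Suc)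
  have a: "reaches code 2 (0, ?s0) (2, ?s1)"
    using code(1) Cons.prems
    by (auto intro!: reaches_step reaches_refl simp: loaded_def numeral_2_eq_2)
  have b: "reaches code 2 (2 + ?D, ?s2) (0, ?s2(0 := tl (?s2 0)))"
    using code(3) by (auto intro!: reaches_step reaches_refl simp: numeral_2_eq_2)
  have c: "?s2(0 := tl (?s2 0)) = loaded R ?D (x # u) v"
    using R by (auto simp: fun_eq_iff loaded_def)
  have "reaches code (?D + 2) (2, ?s1) (0, ?s2(0 := tl (?s2 0)))"
    by (rule reaches_trans[OF reaches_pushes[OF code(2)] b]) simp
  then have "reaches code (?D + 4) (0, ?s0) (0, loaded R ?D (x # u) v)"
    unfolding c by (rule reaches_trans[OF a]) simp
  moreover have "reaches code ((?D + 4) * length v + 1) (0, loaded R ?D (x # u) v)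
      (?D + 4, loaded R ?D (rev v @ x # u) [])"
    using Cons by simp
  ultimately have "reaches code ((?D + 4) * length (x # v) + 1) (0, ?s0)
      (?D + 4, loaded R ?D (rev v @ x # u) [])"
    by (rule reaches_trans) simp
  then show ?case by simp
qed

lemma poly_time_decidable_prog:
  assumes wf: "wf_prog R S p" and R: "2 \<le> R" and S: "1 < S"
    and \<Sigma>: "\<Sigma> \<subseteq> {1..<S}" and L: "L \<subseteq> lists \<Sigma>"
    and correct: "\<And>w s. w \<in> lists \<Sigma> \<Longrightarrow> s 1 = rev w \<Longrightarrow> (\<And>i. i < R \<Longrightarrow> i \<noteq> 1 \<Longrightarrow> s i = []) \<Longrightarrow>
      peek (run (length w) p s out) = 1 \<longleftrightarrow> w \<in> L"
  shows "poly_time_decidable \<Sigma> L"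
proof -
  define D where "D = level p"
  define code where "code = whole_code R out p"
  define K where "K = R + 2 * D"
  let ?M = "stack_tm K S code"
  have len: "length code = D + csize p + 5"
    by (simp add: code_def length_whole_code D_def)
  have wf_code: "\<forall>c\<in>set code. wf_instr K S (length code + 1) c"
  proof
    fix c assume "c \<in> set code"
    moreover have "wf_instr K S (length code + 1) c" if "c \<in> set (compile R p (D + 4))"
      using that by (intro wf_compile[OF wf S]) (auto simp: len K_def D_def)
    ultimately show "wf_instr K S (length code + 1) c"
      using R S by (auto simp: code_def whole_code_def Let_def len[unfolded code_def] K_def D_def)
  qed
  obtain q where q: "\<And>n. cost n p \<le> poly q n" using cost_poly by blast
  let ?T = "\<lambda>n. 2 * ((D + 4) * n + cost n p + 2)"
  \<comment> \<open>Loading takes \<open>(D + 4) * n + 1\<close> instructions, the program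
    \<open>cost n p\<close> and the final test one; every instruction takes at most two machine
    steps.\<close>
  have "decides_in_time ?M \<Sigma> L (\<lambda>n. poly ([:4, 2 * (D + 4):] + [:2:] * q) n)"
    unfolding decides_in_time_def
  proof
    fix w assume w: "w \<in> lists \<Sigma>"
    define n where "n = length w"
    have w0: "0 \<notin> set w" using w \<Sigma> by auto
    have at: "code_at code 0 (whole_code R out p)" by (simp add: code_def code_at_def)
    let ?s = "loaded R D (rev w) []"
    have "stores_input w = loaded R D [] w"
      using R by (auto simp: stores_input_def loaded_def fun_eq_iff)
    then have 1: "reaches code ((D + 4) * n + 1) (0, stores_input w) (D + 4, ?s)"
      using reaches_load[OF at R w0, of "[]"] by (simp add: D_def n_def)
    have 2: "reaches code (cost n p) (D + 4, ?s) (D + 4 + csize p, run n p ?s)"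
    proof (intro reaches_compile[OF wf])
      show "code_at code (D + 4) (compile R p (D + 4))"
        using at by (simp add: whole_code_def Let_def D_def add_ac numeral_eq_Suc)
      \<comment> \<open>Loading fills only the stacks at even distance from \<open>R\<close>, so the
        stacks that count finished iterations start empty.\<close>
      have "R + 2 * j + 1 \<noteq> R + 2 * j'" for j j' by presburger
      then show "\<forall>j<level p. ?s (R + 2 * j) = replicate n 1 \<and> ?s (R + 2 * j + 1) = []"
        using R by (auto simp: loaded_def D_def n_def)
    qed
    have "peek (run n p ?s out) = 1 \<longleftrightarrow> w \<in> L"
      unfolding n_def using R by (intro correct[OF w]) (auto simp: loaded_def)
    \<comment> \<open>The code has length \<open>D + csize p + 5\<close>, so this last jump leads to
      the accepting position, and if it is not taken the code ends in the rejecting one.\<close>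
    moreover have "code_at code (D + 4 + csize p) [IJump (\<lambda>h. h out = 1) (D + csize p + 6)]"
      using at by (simp add: whole_code_def Let_def D_def add_ac numeral_eq_Suc)
    ultimately have 3: "reaches code 1 (D + 4 + csize p, run n p ?s)
        (if w \<in> L then length code + 1 else length code, run n p ?s)"
      by (auto intro!: reaches_one simp: len)
    have "reaches code ((D + 4) * n + cost n p + 2) (0, stores_input w)
        (if w \<in> L then length code + 1 else length code, run n p ?s)"
      by (rule reaches_trans[OF 1 reaches_trans[OF 2 3 order_refl]]) simp
    then obtain t where t: "t \<le> (D + 4) * n + cost n p + 2"
      "(exec code ^^ t) (0, stores_input w) =
         (if w \<in> L then length code + 1 else length code, run n p ?s)"
      by (auto simp: reaches_def)
    have "K \<ge> 1" using R by (simp add: K_def)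
    then obtain ts where ts: "initial ?M w = (0, ts)" "represents K ts (stores_input w)"
      using represents_initial by blast
    obtain k ts' where k: "k \<le> 2 * t" "(step ?M ^^ k) (2 * 0, ts) =
        (2 * (if w \<in> L then length code + 1 else length code), ts')"
      using steps_stack_tm[OF ts(2) wf_code t(2)] by blast
    have "k \<le> 2 * ((D + 4) * n + cost n p + 2)" using order_trans[OF k(1) mult_le_mono2[OF t(1)]] .
    also have "\<dots> \<le> poly ([:4, 2 * (D + 4):] + [:2:] * q) n"
      using q[of n] by (simp add: algebra_simps)
    finally have "k \<le> poly ([:4, 2 * (D + 4):] + [:2:] * q) n" .
    moreover have "fst ((step ?M ^^ k) (initial ?M w)) = (if w \<in> L then accept ?M else reject ?M)"
      using k(2) ts(1) by simp
    ultimately show "\<exists>k\<le>poly ([:4, 2 * (D + 4):] + [:2:] * q) (length w).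
        fst ((step ?M ^^ k) (initial ?M w)) = (if w \<in> L then accept ?M else reject ?M)"
      unfolding n_def by blast
  qed
  moreover have "turing_machine ?M"
    using R S wf_code by (intro turing_machine_stack_tm) (auto simp: K_def)
  moreover have "\<Sigma> \<subseteq> {1..<n_symbols ?M}" using \<Sigma> by simp
  ultimately show ?thesis
    unfolding poly_time_decidable_def using L by blast
qed

section \<open>Procedures on stacks\<close>

declare run.simps(6) [simp del]

abbreviation When :: "((nat \<Rightarrow> nat) \<Rightarrow> bool) \<Rightarrow> prog \<Rightarrow> prog" where
  "When b p \<equiv> Cond b p Skip"

abbreviation While :: "((nat \<Rightarrow> nat) \<Rightarrow> bool) \<Rightarrow> prog \<Rightarrow> prog" where
  "While b p \<equiv> Repeat (When b p)"

lemma run_While: "run n (While b p) s = (run n (When b p) ^^ n) s"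
  by (rule run.simps(6))

lemma funpow_When_stop: "\<not> b (tops s) \<Longrightarrow> (run n (When b p) ^^ k) s = s"
  by (induction k) auto

lemma funpow_When_step:
  "b (tops s) \<Longrightarrow> (run n (When b p) ^^ Suc k) s = (run n (When b p) ^^ k) (run n p s)"
  by (simp add: funpow_swap1)

text \<open>The loop is viewed as a traversal of \<open>xs\<close>, where \<sigma> gives the store
  in terms of the part done and the part left. As each iteration consumes one element,
  \<open>n\<close> of them suffice, and the surplus ones find the condition false. The elements may
  be symbols, numbers or whole votes.\<close>

lemma run_While_list:
  assumes step: "\<And>ys x zs. xs = ys @ x # zs \<Longrightarrow>
      b (tops (\<sigma> ys (x # zs))) \<and> run n p (\<sigma> ys (x # zs)) = \<sigma> (ys @ [x]) zs"
    and stop: "\<not> b (tops (\<sigma> xs []))" and n: "length xs \<le> n"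
    and "s = \<sigma> [] xs" "s' = \<sigma> xs []"
  shows "run n (While b p) s = s'"
proof -
  have "(run n (When b p) ^^ k) (\<sigma> ys zs) = \<sigma> xs []" if "xs = ys @ zs" "length zs \<le> k" for k ys zs
    using that
  proof (induction zs arbitrary: ys k)
    case Nil
    then show ?case using funpow_When_stop[of b, OF stop] by (simp del: run.simps)
  next
    case (Cons x zs)
    then obtain k' where k: "k = Suc k'" by (cases k) auto
    have "(run n (When b p) ^^ k) (\<sigma> ys (x # zs)) = (run n (When b p) ^^ k') (\<sigma> (ys @ [x]) zs)"
      unfolding k using funpow_When_step[where b = b and s = "\<sigma> ys (x # zs)" and p = p] step[of ys x zs] Cons.prems(1)
      by (simp del: run.simps)
    then show ?case using Cons.IH[of "ys @ [x]" k'] Cons.prems k by (simp del: run.simps)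
  qed
  from this[of "[]" xs n] n assms(4,5) show ?thesis by (simp add: run.simps(6))
qed

text \<open>
  \<open>rTmp\<close> is the scratch stack of all procedures. \<open>rTally\<close> holds the number of candidates in unary,
  \<open>rBound\<close> the score that nobody may exceed, and \<open>rBad\<close> is non-empty once a test has failed.
\<close>

abbreviation (input) "rInp \<equiv> 0 :: nat"
abbreviation (input) "rRaw \<equiv> 1 :: nat"
abbreviation (input) "rTmp \<equiv> 2 :: nat"
abbreviation (input) "rPref \<equiv> 3 :: nat"
abbreviation (input) "rCands \<equiv> 4 :: nat"
abbreviation (input) "rTally \<equiv> 5 :: nat"
abbreviation (input) "rStream \<equiv> 6 :: nat"
abbreviation (input) "rWeight \<equiv> 7 :: nat"
abbreviation (input) "rVote \<equiv> 8 :: nat"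
abbreviation (input) "rTodo \<equiv> 9 :: nat"
abbreviation (input) "rElem \<equiv> 10 :: nat"
abbreviation (input) "rList \<equiv> 11 :: nat"
abbreviation (input) "rItem \<equiv> 12 :: nat"
abbreviation (input) "rFlag \<equiv> 13 :: nat"
abbreviation (input) "rBad \<equiv> 14 :: nat"
abbreviation (input) "rSum \<equiv> 15 :: nat"
abbreviation (input) "rBound \<equiv> 16 :: nat"
abbreviation (input) "rBound2 \<equiv> 17 :: nat"
abbreviation (input) "rRoom \<equiv> 18 :: nat"
abbreviation (input) "rCarry \<equiv> 19 :: nat"
abbreviation (input) "rVote2 \<equiv> 20 :: nat"
abbreviation (input) "rState \<equiv> 21 :: nat"
abbreviation (input) "rState2 \<equiv> 22 :: nat"
abbreviation (input) "rOut \<equiv> 23 :: nat"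
abbreviation (input) "rCand \<equiv> 24 :: nat"

section \<open>Moving, splitting and comparing stacks\<close>

definition rev_onto :: "nat \<Rightarrow> nat \<Rightarrow> prog" where
  "rev_onto a b = While (\<lambda>h. h a \<noteq> 0) (Push b (\<lambda>h. h a) ;; Pop a)"

lemma run_rev_onto:
  assumes "a \<noteq> b" "0 \<notin> set (s a)" "length (s a) \<le> n"
  shows "run n (rev_onto a b) s = s(a := [], b := rev (s a) @ s b)"
  unfolding rev_onto_def
  by (rule run_While_list[where xs = "s a" and \<sigma> = "\<lambda>ys zs. s(a := zs, b := rev ys @ s b)"])
    (use assms in \<open>auto simp: fun_eq_iff\<close>)

definition clear :: "nat \<Rightarrow> prog" where
  "clear a = While (\<lambda>h. h a \<noteq> 0) (Pop a)"

lemma run_clear: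
  assumes "0 \<notin> set (s a)" "length (s a) \<le> n"
  shows "run n (clear a) s = s(a := [])"
  unfolding clear_def
  by (rule run_While_list[where xs = "s a" and \<sigma> = "\<lambda>ys zs. s(a := zs)"])
    (use assms in \<open>auto simp: fun_eq_iff\<close>)

definition copy :: "nat \<Rightarrow> nat \<Rightarrow> prog" where
  "copy a b = rev_onto a rTmp ;;
     While (\<lambda>h. h rTmp \<noteq> 0) (Push a (\<lambda>h. h rTmp) ;; Push b (\<lambda>h. h rTmp) ;; Pop rTmp)"

lemma run_copy:
  assumes "distinct [a, b, rTmp]" "0 \<notin> set (s a)" "length (s a) \<le> n" "s rTmp = []"
  shows "run n (copy a b) s = s(b := s a @ s b)"
proof -
  have "run n (While (\<lambda>h. h rTmp \<noteq> 0) (Push a (\<lambda>h. h rTmp) ;; Push b (\<lambda>h. h rTmp) ;; Pop rTmp))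
      (s(a := [], rTmp := rev (s a))) = s(b := s a @ s b)"
    by (rule run_While_list[where xs = "rev (s a)" and
        \<sigma> = "\<lambda>ys zs. s(a := rev ys, b := rev ys @ s b, rTmp := zs)"])
      (use assms in \<open>auto simp: fun_eq_iff dest: arg_cong[of _ _ set]\<close>)
  then show ?thesis unfolding copy_def
    using assms by (simp add: run_rev_onto)
qed

text \<open>The detour through \<open>rTmp\<close> preserves the order, and the separate
  \<open>Pop a\<close> discards the terminator.\<close>

definition split :: "nat \<Rightarrow> nat \<Rightarrow> nat \<Rightarrow> prog" where
  "split c a b = While (\<lambda>h. h a \<noteq> 0 \<and> h a \<noteq> c) (Push rTmp (\<lambda>h. h a) ;; Pop a) ;; Pop a ;; rev_onto rTmp b"

lemma run_split:
  assumes "distinct [a, b, rTmp]" "0 \<notin> set (s a)" "length (s a) \<le> n" "s rTmp = []"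
  shows "run n (split c a b) s =
    s(a := tl (dropWhile (\<lambda>x. x \<noteq> c) (s a)), b := takeWhile (\<lambda>x. x \<noteq> c) (s a) @ s b)"
proof -
  define u v where uv: "u = takeWhile (\<lambda>x. x \<noteq> c) (s a)" "v = dropWhile (\<lambda>x. x \<noteq> c) (s a)"
  have sa: "s a = u @ v" by (simp add: uv)
  have u: "x \<in> set (s a) \<and> x \<noteq> c" if "x \<in> set u" for x
    using that set_takeWhileD unfolding uv by metis
  have v: "v = [] \<or> hd v = c"
    using hd_dropWhile[of "\<lambda>x. x \<noteq> c" "s a"] unfolding uv by blast
  have len: "length u \<le> n" using assms(3) sa by simp
  have "run n (While (\<lambda>h. h a \<noteq> 0 \<and> h a \<noteq> c) (Push rTmp (\<lambda>h. h a) ;; Pop a)) s =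
      s(a := v, rTmp := rev u)"
  proof (rule run_While_list[where xs = u and \<sigma> = "\<lambda>ys zs. s(a := zs @ v, rTmp := rev ys)"])
    fix ys x zs assume "u = ys @ x # zs"
    then have "x \<in> set u" by simp
    then have "x \<noteq> 0" "x \<noteq> c" using u assms(2) by metis+
    let ?s = "s(a := (x # zs) @ v, rTmp := rev ys)"
    show "(peek (?s a) \<noteq> 0 \<and> peek (?s a) \<noteq> c) \<and>
      run n (Push rTmp (\<lambda>h. h a) ;; Pop a) (s(a := (x # zs) @ v, rTmp := rev ys)) =
      s(a := zs @ v, rTmp := rev (ys @ [x]))"
      using assms(1) \<open>x \<noteq> 0\<close> \<open>x \<noteq> c\<close> by (auto simp: fun_eq_iff)
  next
    let ?s = "s(a := [] @ v, rTmp := rev u)"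
    show "\<not> (peek (?s a) \<noteq> 0 \<and> peek (?s a) \<noteq> c)"
      using assms(1) v by (cases v) auto
  qed (use assms len sa in \<open>auto simp: fun_eq_iff\<close>)
  moreover have "0 \<notin> set u" using u assms(2) by blast
  ultimately show ?thesis
    unfolding split_def uv[symmetric] using assms(1,4) len by (auto simp: run_rev_onto fun_eq_iff)
qed

text \<open>The common prefix is parked on \<open>rTmp\<close> and put back, so \<open>a\<close>
  survives while \<open>b\<close> is used up: the same number can be compared with many items in
  turn.\<close>

definition test_eq :: "nat \<Rightarrow> nat \<Rightarrow> nat \<Rightarrow> prog" where
  "test_eq a b f =
     While (\<lambda>h. h a \<noteq> 0 \<and> h a = h b) (Push rTmp (\<lambda>h. h a) ;; Pop a ;; Pop b) ;;
     When (\<lambda>h. h a = 0 \<and> h b = 0) (Push f (\<lambda>_. 1)) ;; clear b ;; rev_onto rTmp a"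

text \<open>Supplies the list \<open>ps\<close> that the loop of \<open>test_eq\<close> traverses
  and the reason why it stops after it.\<close>

lemma common_prefix:
  "\<exists>ps us vs. xs = ps @ us \<and> ys = ps @ vs \<and> (us = [] \<or> vs = [] \<or> hd us \<noteq> hd vs)"
proof (induction xs arbitrary: ys)
  case (Cons x xs)
  show ?case
  proof (cases "ys \<noteq> [] \<and> hd ys = x")
    case True
    then obtain ys' where ys: "ys = x # ys'" by (cases ys) auto
    obtain ps us vs where "xs = ps @ us" "ys' = ps @ vs" "us = [] \<or> vs = [] \<or> hd us \<noteq> hd vs"
      using Cons by blast
    then show ?thesis using ys
      by (intro exI[of _ "x # ps"] exI[of _ us] exI[of _ vs]) auto
  next
    case False
    then show ?thesis by (intro exI[of _ "[]"] exI[of _ "x # xs"] exI[of _ ys]) auto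
  qed
qed auto

lemma peek_eq_0: "0 \<notin> set xs \<Longrightarrow> peek xs = 0 \<longleftrightarrow> xs = []"
  by (cases xs) auto

lemma run_test_eq:
  assumes "distinct [a, b, f, rTmp]" "0 \<notin> set (s a)" "0 \<notin> set (s b)"
    "length (s a) \<le> n" "length (s b) \<le> n" "s rTmp = []"
  shows "run n (test_eq a b f) s =
    s(b := [], f := (if s a = s b then 1 # s f else s f))"
proof -
  obtain ps us vs where sa: "s a = ps @ us" and sb: "s b = ps @ vs"
    and diff: "us = [] \<or> vs = [] \<or> hd us \<noteq> hd vs"
    using common_prefix by blast
  have nz: "0 \<notin> set ps" "0 \<notin> set us" "0 \<notin> set vs" using assms(2,3) sa sb by auto
  let ?s = "s(a := us, b := vs, rTmp := rev ps)"
  have "run n (While (\<lambda>h. h a \<noteq> 0 \<and> h a = h b) (Push rTmp (\<lambda>h. h a) ;; Pop a ;; Pop b)) s = ?s"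
  proof (rule run_While_list[where xs = ps and \<sigma> = "\<lambda>ys zs. s(a := zs @ us, b := zs @ vs, rTmp := rev ys)"])
    let ?s = "s(a := [] @ us, b := [] @ vs, rTmp := rev ps)"
    show "\<not> (peek (?s a) \<noteq> 0 \<and> peek (?s a) = peek (?s b))"
      using assms(1) diff nz by (cases us; cases vs) auto
  qed (use assms(1,4,6) sa sb nz in \<open>auto simp: fun_eq_iff\<close>)
  then show ?thesis
    unfolding test_eq_def using assms(1,4,5,6) sa sb nz diff
    by (cases us; cases vs) (auto simp: run_clear run_rev_onto fun_eq_iff)
qed

section \<open>Numerals and lists of numerals on stacks\<close>

lemma binary_0 [simp]: "binary 0 = []"
  by (simp add: binary.simps)

lemma binary_eq_Nil [simp]: "binary k = [] \<longleftrightarrow> k = 0"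
  by (subst binary.simps) auto

lemma binary_eq_iff [simp]: "binary a = binary b \<longleftrightarrow> a = b"
  using binary_inject by blast

lemma zero_notin_binary [simp]: "0 \<notin> set (binary k)"
  using binary_digits[of 0 k] by auto

lemma takeWhile_binary [simp]: "takeWhile (\<lambda>x. x \<noteq> 3) (binary k @ 3 # xs) = binary k"
  using binary_digits[of 3 k] by (subst takeWhile_append2) auto

lemma dropWhile_binary [simp]: "dropWhile (\<lambda>x. x \<noteq> 3) (binary k @ 3 # xs) = 3 # xs"
  using binary_digits[of 3 k] by (subst dropWhile_append2) auto

lemma peek_binary: "peek (binary k) = (if k = 0 then 0 else k mod 2 + 1)"
  by (subst binary.simps) auto

lemma tl_binary: "tl (binary k) = binary (k div 2)"
  by (subst binary.simps) auto

lemma length_binary: "length (binary k) = (if k = 0 then 0 else Suc (length (binary (k div 2))))"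
  by (subst binary.simps) auto

text \<open>An encoded list without its final 4, which is what \<open>split 4\<close>
  delivers.\<close>

definition nums :: "nat list \<Rightarrow> nat list" where
  "nums ks = concat (map enc_number ks)"

lemma nums_Nil [simp]: "nums [] = []"
  by (simp add: nums_def)

lemma nums_Cons [simp]: "nums (k # ks) = binary k @ 3 # nums ks"
  by (simp add: nums_def enc_number_def)

lemma nums_append [simp]: "nums (ks @ ls) = nums ks @ nums ls"
  by (simp add: nums_def)

lemma zero_notin_nums [simp]: "0 \<notin> set (nums ks)"
  by (induction ks) auto

lemma four_notin_nums: "4 \<notin> set (nums ks)"
  using binary_digits[of 4] by (induction ks) auto

lemma takeWhile_nums [simp]: "takeWhile (\<lambda>x. x \<noteq> 4) (nums ks @ 4 # xs) = nums ks"
  using four_notin_nums[of ks] by (subst takeWhile_append2) auto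

lemma dropWhile_nums [simp]: "dropWhile (\<lambda>x. x \<noteq> 4) (nums ks @ 4 # xs) = 4 # xs"
  using four_notin_nums[of ks] by (subst dropWhile_append2) auto

lemma nums_eq_Nil [simp]: "nums ks = [] \<longleftrightarrow> ks = []"
  by (cases ks) auto

lemma length_le_nums: "length ks \<le> length (nums ks)"
  by (induction ks) auto

lemma peek_binary_append [simp]: "peek (binary k @ 3 # xs) \<noteq> 0" "peek (binary k @ 3 # xs) \<noteq> 4"
proof -
  have "k mod 2 < 2" by simp
  then have "k mod 2 + 1 \<noteq> 4" by linarith
  then show "peek (binary k @ 3 # xs) \<noteq> 4" by (subst binary.simps) auto
  show "peek (binary k @ 3 # xs) \<noteq> 0" by (subst binary.simps) auto
qed

text \<open>Occurrences are counted in unary on \<open>rFlag\<close> rather than merely detected, so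
  that one procedure serves for both membership and duplicates.\<close>

definition count_item :: prog where
  "count_item =
     While (\<lambda>h. h rList \<noteq> 0) (split 3 rList rItem ;; test_eq rElem rItem rFlag)"

lemma run_count_item:
  assumes "s rList = nums ks" "s rElem = binary k" "s rItem = []" "s rTmp = []"
    "length (nums ks) \<le> n" "length (binary k) \<le> n"
  shows "run n count_item s = s(rList := [], rFlag := replicate (count_list ks k) 1 @ s rFlag)"
  unfolding count_item_def
proof (rule run_While_list[where xs = ks and
      \<sigma> = "\<lambda>ys zs. s(rList := nums zs, rFlag := replicate (count_list ys k) 1 @ s rFlag)"])
  fix ys x zs assume ks: "ks = ys @ x # zs"
  let ?s = "s(rList := nums (x # zs), rFlag := replicate (count_list ys k) 1 @ s rFlag)"
  show "peek (?s rList) \<noteq> 0 \<and> run n (split 3 rList rItem ;; test_eq rElem rItem rFlag) ?s =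
      s(rList := nums zs, rFlag := replicate (count_list (ys @ [x]) k) 1 @ s rFlag)"
    using assms ks by (simp add: run_split run_test_eq) (auto simp: fun_eq_iff)
qed (use assms length_le_nums[of ks] in \<open>auto simp: fun_eq_iff\<close>)

definition flag :: "bool \<Rightarrow> nat list" where
  "flag b = (if b then [1] else [])"

lemma peek_flag [simp]: "peek (flag b) = (if b then 1 else 0)"
  by (simp add: flag_def)

definition set_bad :: prog where
  "set_bad = When (\<lambda>h. h rBad = 0) (Push rBad (\<lambda>_. 1))"

lemma run_set_bad: "s rBad = flag b \<Longrightarrow> run n set_bad s = s(rBad := flag True)"
  by (auto simp: set_bad_def flag_def fun_eq_iff)

text \<open>Each entry of the vote certainly occurs once in it; \<open>Pop rFlag\<close> removes
  that occurrence, and anything left on the flag reveals a duplicate. The second count looks the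
  entry up among the candidates. The empty vote passes and has to be excluded separately.\<close>

definition check_vote :: prog where
  "check_vote = copy rVote rTodo ;;
     While (\<lambda>h. h rTodo \<noteq> 0)
       (split 3 rTodo rElem ;;
        copy rVote rList ;; count_item ;; Pop rFlag ;; When (\<lambda>h. h rFlag \<noteq> 0) set_bad ;;
        clear rFlag ;;
        copy rCands rList ;; count_item ;; When (\<lambda>h. h rFlag = 0) set_bad ;;
        clear rFlag ;; clear rElem)"

lemma distinct_count_list: "distinct xs \<longleftrightarrow> (\<forall>x\<in>set xs. count_list xs x = 1)"
  by (induction xs) (auto simp: count_list_0_iff)

lemma peek_replicate: "peek (replicate k (Suc 0)) = (if k = 0 then 0 else 1)"
  by (cases k) auto

lemma count_list_length_nums: "count_list ks k \<le> length (nums ks)"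
  using count_le_length[of ks k] length_le_nums[of ks] by linarith

lemma run_check_vote:
  assumes s: "s rVote = nums v" "s rCands = nums C" "s rBad = flag b"
    "s rTmp = []" "s rTodo = []" "s rElem = []" "s rList = []" "s rItem = []" "s rFlag = []"
    and n: "length (nums v) \<le> n" "length (nums C) \<le> n"
  shows "run n check_vote s = s(rBad := flag (b \<or> \<not> (distinct v \<and> set v \<subseteq> set C)))"
proof -
  define bad where "bad x \<longleftrightarrow> count_list v x \<noteq> 1 \<or> x \<notin> set C" for x
  let ?body = "split 3 rTodo rElem ;;
        copy rVote rList ;; count_item ;; Pop rFlag ;; When (\<lambda>h. h rFlag \<noteq> 0) set_bad ;;
        clear rFlag ;;
        copy rCands rList ;; count_item ;; When (\<lambda>h. h rFlag = 0) set_bad ;;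
        clear rFlag ;; clear rElem"
  have "run n (While (\<lambda>h. h rTodo \<noteq> 0) ?body) (s(rTodo := nums v)) =
      s(rBad := flag (b \<or> (\<exists>x\<in>set v. bad x)))"
  proof (rule run_While_list[where xs = v and
        \<sigma> = "\<lambda>ys zs. s(rTodo := nums zs, rBad := flag (b \<or> (\<exists>x\<in>set ys. bad x)))"])
    fix ys x zs assume v: "v = ys @ x # zs"
    define b1 where "b1 \<longleftrightarrow> b \<or> (\<exists>x\<in>set ys. bad x)"
    have x: "count_list v x \<noteq> 0" using v by (simp add: count_list_0_iff)
    have len: "length (binary x) \<le> n" "length (binary x @ 3 # nums zs) \<le> n" using n v by auto
    have c: "count_list v x - 1 \<le> n" "count_list C x \<le> n"
      using count_list_length_nums[of v x] count_list_length_nums[of C x] n by linarith+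
    let ?s = "s(rTodo := nums (x # zs), rBad := flag b1)"
    let ?s1 = "?s(rTodo := nums zs, rElem := binary x)"
    let ?s2 = "?s1(rBad := flag (b1 \<or> count_list v x \<noteq> 1))"
    let ?s3 = "?s1(rBad := flag (b1 \<or> bad x))"
    have 1: "run n (split 3 rTodo rElem) ?s = ?s1"
      using s len by (simp add: run_split)
    have 2: "run n (copy rVote rList ;; count_item ;; Pop rFlag ;; When (\<lambda>h. h rFlag \<noteq> 0) set_bad ;;
        clear rFlag) ?s1 = ?s2"
      using s n len c x
      by (simp add: run_copy run_count_item[where ks = v and k = x])
        (auto simp: run_set_bad run_clear peek_replicate fun_eq_iff intro!: arg_cong[of _ _ flag])
    have 3: "run n (copy rCands rList ;; count_item ;; When (\<lambda>h. h rFlag = 0) set_bad ;;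
        clear rFlag) ?s2 = ?s3"
      using s n len c x
      by (simp add: run_copy run_count_item[where ks = C and k = x])
        (auto simp: run_set_bad run_clear peek_replicate fun_eq_iff count_list_0_iff bad_def
          intro!: arg_cong[of _ _ flag])
    have 4: "run n (clear rElem) ?s3 = s(rTodo := nums zs, rBad := flag (b1 \<or> bad x))"
      using s len by (auto simp: run_clear fun_eq_iff)
    have "run n ?body ?s = s(rTodo := nums zs, rBad := flag (b1 \<or> bad x))"
      using 1 2 3 4 by simp
    then show "peek (?s rTodo) \<noteq> 0 \<and> run n ?body ?s =
        s(rTodo := nums zs, rBad := flag (b \<or> (\<exists>x\<in>set (ys @ [x]). bad x)))"
      by (simp add: b1_def disj_ac)
  qed (use s n length_le_nums[of v] in \<open>auto simp: fun_eq_iff\<close>)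
  moreover have "(\<exists>x\<in>set v. bad x) \<longleftrightarrow> \<not> (distinct v \<and> set v \<subseteq> set C)"
    by (auto simp: bad_def distinct_count_list)
  ultimately show ?thesis
    unfolding check_vote_def using s n by (simp add: run_copy)
qed

section \<open>Binary addition and comparison\<close>

definition digit :: "nat \<Rightarrow> nat" where
  "digit x = (if x = 2 then 1 else 0)"

text \<open>Valid for \<open>k = 0\<close> as well: the blank counts as the digit zero, so the
  shorter of two numbers is padded with zeros by itself.\<close>

lemma digit_peek_binary [simp]: "digit (peek (binary k)) = k mod 2"
  by (auto simp: digit_def peek_binary)

definition add_step :: prog where
  "add_step =
     Push rTmp (\<lambda>h. (digit (h rSum) + digit (h rWeight) + digit (h rCarry)) mod 2 + 1) ;;
     Cond (\<lambda>h. digit (h rSum) + digit (h rWeight) + digit (h rCarry) \<ge> 2)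
       (When (\<lambda>h. h rCarry = 0) (Push rCarry (\<lambda>_. 2))) (Pop rCarry) ;;
     Pop rSum ;; Pop rWeight"

definition add :: prog where
  "add = While (\<lambda>h. h rSum \<noteq> 0 \<or> h rWeight \<noteq> 0 \<or> h rCarry \<noteq> 0) add_step ;; rev_onto rTmp rSum"

text \<open>The carry is kept as a numeral too, \<open>[]\<close> or \<open>[2]\<close>, which turns
  addition into halving the sum of three numbers.\<close>

definition add_state :: "store \<Rightarrow> nat \<Rightarrow> nat \<Rightarrow> nat \<Rightarrow> nat list \<Rightarrow> store" where
  "add_state s a b c ys =
     s(rSum := binary a, rWeight := binary b, rCarry := binary c, rTmp := ys)"

lemma binary_1 [simp]: "binary (Suc 0) = [2]"
  by (simp add: binary.simps)

lemma run_add_step: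
  assumes "c < 2"
  shows "run n add_step (add_state s a b c ys) =
    add_state s (a div 2) (b div 2) ((a mod 2 + b mod 2 + c) div 2)
      (((a mod 2 + b mod 2 + c) mod 2 + 1) # ys)"
proof -
  have ab: "a mod 2 < 2" "b mod 2 < 2" by simp_all
  have c: "c = 0 \<or> c = 1" using assms by linarith
  define t where "t = a mod 2 + b mod 2 + c"
  have "t = 0 \<or> t = 1 \<or> t = 2 \<or> t = 3" using ab assms unfolding t_def by linarith
  then have t: "t div 2 = (if 2 \<le> t then 1 else 0)" by auto
  have bc: "peek (binary c) = 0 \<longleftrightarrow> c = 0" "tl (binary c) = []" "c = 0 \<or> binary c = [2]" "c mod 2 = c"
    using c by auto
  show ?thesis
    unfolding t_def[symmetric] t using bc
    by (auto simp: add_step_def add_state_def fun_eq_iff tl_binary t_def[symmetric])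
qed

lemma run_add_loop:
  assumes "c < 2" "length (binary (a + b + c)) \<le> k"
  shows "(run n (When (\<lambda>h. h rSum \<noteq> 0 \<or> h rWeight \<noteq> 0 \<or> h rCarry \<noteq> 0) add_step) ^^ k)
      (add_state s a b c ys) = add_state s 0 0 0 (rev (binary (a + b + c)) @ ys)"
  using assms
proof (induction k arbitrary: a b c ys)
  case 0
  then show ?case by simp
next
  case (Suc k)
  define t where "t = a mod 2 + b mod 2 + c"
  define m where "m = a + b + c"
  let ?b = "\<lambda>h. h rSum \<noteq> 0 \<or> h rWeight \<noteq> 0 \<or> h rCarry \<noteq> (0 :: nat)"
  show ?case
  proof (cases "m = 0")
    case True
    then have "a = 0" "b = 0" "c = 0" by (simp_all add: m_def)
    then show ?thesis by (subst funpow_When_stop) (auto simp: add_state_def)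
  next
    case False
    have "a + b + c = 2 * (x + y) + (u + v + c)" if "2 * x + u = a" "2 * y + v = b" for x y u v
      unfolding that[symmetric] by simp
    from this[OF mult_div_mod_eq mult_div_mod_eq]
    have "m = 2 * (a div 2 + b div 2) + t" unfolding t_def m_def .
    moreover have "(2 * j + t) div 2 = j + t div 2" "(2 * j + t) mod 2 = t mod 2" for j
      by simp_all
    ultimately have d: "m div 2 = a div 2 + b div 2 + t div 2" "m mod 2 = t mod 2" by metis+
    have "a mod 2 < 2" "b mod 2 < 2" by simp_all
    then have "t < 4" using Suc.prems(1) unfolding t_def by linarith
    then have t: "t div 2 < 2" by linarith
    have len: "length (binary (a div 2 + b div 2 + t div 2)) \<le> k"
      using Suc.prems(2) False length_binary[of m] by (simp flip: d m_def)
    have m: "binary m = (t mod 2 + 1) # binary (a div 2 + b div 2 + t div 2)"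
      using False by (subst binary.simps) (simp add: d)
    have "(run n (When ?b add_step) ^^ Suc k) (add_state s a b c ys) =
        (run n (When ?b add_step) ^^ k) (run n add_step (add_state s a b c ys))"
    proof (rule funpow_When_step)
      have "a \<noteq> 0 \<or> b \<noteq> 0 \<or> c \<noteq> 0" using False by (simp add: m_def)
      then show "?b (tops (add_state s a b c ys))" by (auto simp: add_state_def peek_binary)
    qed
    also have "run n add_step (add_state s a b c ys) =
        add_state s (a div 2) (b div 2) (t div 2) ((t mod 2 + 1) # ys)"
      unfolding run_add_step[OF Suc.prems(1)] t_def by (rule refl)
    also have "(run n (When ?b add_step) ^^ k) \<dots> =
        add_state s 0 0 0 (rev (binary (a div 2 + b div 2 + t div 2)) @ (t mod 2 + 1) # ys)"
      by (rule Suc.IH[OF t len])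
    also have "\<dots> = add_state s 0 0 0 (rev (binary m) @ ys)" by (simp add: m)
    finally show ?thesis by (simp only: m_def)
  qed
qed

lemma run_add:
  assumes "s rSum = binary a" "s rWeight = binary b" "s rCarry = []" "s rTmp = []"
    "length (binary (a + b)) \<le> n"
  shows "run n add s = s(rSum := binary (a + b), rWeight := [])"
proof -
  have "s = add_state s a b 0 []"
    using assms by (auto simp: add_state_def fun_eq_iff)
  then have "run n (While (\<lambda>h. h rSum \<noteq> 0 \<or> h rWeight \<noteq> 0 \<or> h rCarry \<noteq> 0) add_step) s =
      add_state s 0 0 0 (rev (binary (a + b)))"
    using run_add_loop[of 0 a b n n s "[]"] assms(5) by (simp del: run.simps add: run_While)
  then show ?thesis
    using assms by (auto simp: add_def run_rev_onto add_state_def fun_eq_iff)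
qed

text \<open>Digits arrive least significant first, so an unequal pair overrides the verdict so far
  and an equal pair keeps it.\<close>

definition compare_step :: prog where
  "compare_step =
     Cond (\<lambda>h. digit (h rBound2) < digit (h rSum))
       (When (\<lambda>h. h rFlag = 0) (Push rFlag (\<lambda>_. 1)))
       (When (\<lambda>h. digit (h rSum) < digit (h rBound2)) (Pop rFlag)) ;;
     Pop rSum ;; Pop rBound2"

definition compare :: prog where
  "compare = While (\<lambda>h. h rSum \<noteq> 0 \<or> h rBound2 \<noteq> 0) compare_step"

definition compare_state :: "store \<Rightarrow> nat \<Rightarrow> nat \<Rightarrow> bool \<Rightarrow> store" where
  "compare_state s a b f = s(rSum := binary a, rBound2 := binary b, rFlag := flag f)"

lemma run_compare_step:
  "run n compare_step (compare_state s a b f) =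
     compare_state s (a div 2) (b div 2) (b mod 2 < a mod 2 \<or> a mod 2 = b mod 2 \<and> f)"
proof -
  have "a mod 2 < 2" "b mod 2 < 2" by simp_all
  then have "a mod 2 = 0 \<or> a mod 2 = 1" "b mod 2 = 0 \<or> b mod 2 = 1"
    by linarith+
  then show ?thesis
    by (elim disjE)
      (auto simp: compare_step_def compare_state_def fun_eq_iff tl_binary flag_def)
qed

text \<open>The invariant of the comparison, with \<open>f\<close> the verdict on the digits already
  consumed: a digit can contribute at most 1, which never outweighs a difference of the
  halves.\<close>

lemma less_by_digits:
  fixes a b :: nat
  shows "b div 2 < a div 2 \<or> a div 2 = b div 2 \<and> (b mod 2 < a mod 2 \<or> a mod 2 = b mod 2 \<and> f)
    \<longleftrightarrow> b < a \<or> a = b \<and> f"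
proof -
  have "y < x \<or> x = y \<and> (v < u \<or> u = v \<and> f) \<longleftrightarrow> 2 * y + v < 2 * x + u \<or> 2 * x + u = 2 * y + v \<and> f"
    if "u < 2" "v < 2" for x y u v :: nat
    by (cases x y rule: linorder_cases) (use that in auto)
  from this[of "a mod 2" "b mod 2" "b div 2" "a div 2"] show ?thesis
    unfolding mult_div_mod_eq by simp
qed

lemma run_compare_loop:
  assumes "length (binary a) \<le> k" "length (binary b) \<le> k"
  shows "(run n (When (\<lambda>h. h rSum \<noteq> 0 \<or> h rBound2 \<noteq> 0) compare_step) ^^ k) (compare_state s a b f) =
    compare_state s 0 0 (b < a \<or> a = b \<and> f)"
  using assms
proof (induction k arbitrary: a b f)
  case 0
  then show ?case by simp
next
  case (Suc k)
  let ?b = "\<lambda>h. h rSum \<noteq> 0 \<or> h rBound2 \<noteq> (0 :: nat)"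
  show ?case
  proof (cases "a = 0 \<and> b = 0")
    case True
    then show ?thesis by (subst funpow_When_stop) (auto simp: compare_state_def)
  next
    case False
    have "length (binary (a div 2)) \<le> k" "length (binary (b div 2)) \<le> k"
      using Suc.prems length_binary[of a] length_binary[of b] by (auto split: if_splits)
    note IH = Suc.IH[OF this]
    have "(run n (When ?b compare_step) ^^ Suc k) (compare_state s a b f) =
        (run n (When ?b compare_step) ^^ k) (run n compare_step (compare_state s a b f))"
      by (rule funpow_When_step) (use False in \<open>auto simp: compare_state_def peek_binary\<close>)
    also have "\<dots> = compare_state s 0 0 (b < a \<or> a = b \<and> f)"
      unfolding run_compare_step IH less_by_digits ..
    finally show ?thesis .
  qed
qed

lemma run_compare:
  assumes "s rSum = binary a" "s rBound2 = binary b" "s rFlag = []"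
    "length (binary a) \<le> n" "length (binary b) \<le> n"
  shows "run n compare s = s(rSum := [], rBound2 := [], rFlag := flag (b < a))"
proof -
  have "s = compare_state s a b False"
    using assms by (auto simp: compare_state_def flag_def fun_eq_iff)
  then show ?thesis
    using run_compare_loop[of a n b n s False] assms(4,5)
    by (simp del: run.simps add: compare_def run_While) (simp add: compare_state_def)
qed

section \<open>Unary counts of candidates\<close>

definition tally :: prog where
  "tally = copy rCands rStream ;;
     While (\<lambda>h. h rStream \<noteq> 0) (When (\<lambda>h. h rStream = 3) (Push rTally (\<lambda>_. 1)) ;; Pop rStream)"

text \<open>The symbol 3 ends every number and is not a digit, so counting it counts the
  numbers.\<close>

lemma count_three_nums: "count_list (nums ks) 3 = length ks"
proof (induction ks)
  case (Cons k ks)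
  have "count_list (binary k) 3 = 0"
    using binary_digits[of 3 k] by (auto simp: count_list_0_iff)
  then show ?case using Cons by simp
qed simp

lemma run_tally:
  assumes "s rCands = nums C" "s rStream = []" "s rTally = []" "s rTmp = []" "length (nums C) \<le> n"
  shows "run n tally s = s(rTally := replicate (length C) 1)"
proof -
  have "run n (While (\<lambda>h. h rStream \<noteq> 0)
        (When (\<lambda>h. h rStream = 3) (Push rTally (\<lambda>_. 1)) ;; Pop rStream)) (s(rStream := nums C)) =
      s(rTally := replicate (count_list (nums C) 3) 1)"
  proof (rule run_While_list[where xs = "nums C" and
      \<sigma> = "\<lambda>ys zs. s(rStream := zs, rTally := replicate (count_list ys 3) 1)"])
    fix ys x zs assume "nums C = ys @ x # zs"
    then have "x \<in> set (nums C)" by simp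
    then have "x \<noteq> 0" using zero_notin_nums by metis
    let ?s = "s(rStream := x # zs, rTally := replicate (count_list ys 3) 1)"
    show "peek (?s rStream) \<noteq> 0 \<and>
        run n (When (\<lambda>h. h rStream = 3) (Push rTally (\<lambda>_. 1)) ;; Pop rStream) ?s =
        s(rStream := zs, rTally := replicate (count_list (ys @ [x]) 3) 1)"
      using \<open>x \<noteq> 0\<close> by (auto simp: fun_eq_iff)
  qed (use assms in \<open>auto simp: fun_eq_iff\<close>)
  then show ?thesis unfolding tally_def
    using assms by (simp add: run_copy count_three_nums)
qed

text \<open>Popping an empty stack does nothing, in agreement with truncated subtraction. Copies are
  used because the tally is needed for the other votes and the vote for the bit.\<close>

definition subtract :: prog where
  "subtract = copy rTally rRoom ;; copy rVote rVote2 ;;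
     While (\<lambda>h. h rVote2 \<noteq> 0) (When (\<lambda>h. h rVote2 = 3) (Pop rRoom) ;; Pop rVote2)"

lemma run_subtract:
  assumes "s rVote = nums v" "s rTally = replicate m 1" "s rVote2 = []" "s rRoom = []" "s rTmp = []"
    "length (nums v) \<le> n" "m \<le> n"
  shows "run n subtract s = s(rRoom := replicate (m - length v) 1)"
proof -
  have "run n (While (\<lambda>h. h rVote2 \<noteq> 0) (When (\<lambda>h. h rVote2 = 3) (Pop rRoom) ;; Pop rVote2))
      (s(rRoom := replicate m 1, rVote2 := nums v)) =
      s(rRoom := replicate (m - count_list (nums v) 3) 1)"
  proof (rule run_While_list[where xs = "nums v" and
      \<sigma> = "\<lambda>ys zs. s(rRoom := replicate (m - count_list ys 3) 1, rVote2 := zs)"])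
    fix ys x zs assume "nums v = ys @ x # zs"
    then have "x \<in> set (nums v)" by simp
    then have "x \<noteq> 0" using zero_notin_nums by metis
    let ?s = "s(rRoom := replicate (m - count_list ys 3) 1, rVote2 := x # zs)"
    have "tl (replicate (m - k) (1 :: nat)) = replicate (m - Suc k) 1" for k
      by (cases "m - k") (auto simp: Suc_diff_Suc[symmetric] diff_Suc)
    then show "peek (?s rVote2) \<noteq> 0 \<and>
        run n (When (\<lambda>h. h rVote2 = 3) (Pop rRoom) ;; Pop rVote2) ?s =
        s(rRoom := replicate (m - count_list (ys @ [x]) 3) 1, rVote2 := zs)"
      using \<open>x \<noteq> 0\<close> by (auto simp: fun_eq_iff)
  qed (use assms in \<open>auto simp: fun_eq_iff\<close>)
  then show ?thesis unfolding subtract_def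
    using assms by (simp add: run_copy count_three_nums)
qed

section \<open>Scores\<close>

lemma length_binary_le: "k < 2 ^ n \<Longrightarrow> length (binary k) \<le> n"
proof (induction n arbitrary: k)
  case (Suc n)
  then have "length (binary (k div 2)) \<le> n" by simp
  then show ?case by (subst length_binary) simp
qed simp

definition vote_words :: "(nat \<times> nat list) list \<Rightarrow> nat list" where
  "vote_words V = concat (map (\<lambda>(w, v). enc_number w @ enc_numbers v) V)"

lemma vote_words_Nil [simp]: "vote_words [] = []"
  by (simp add: vote_words_def)

lemma vote_words_Cons [simp]: "vote_words ((w, v) # V) = binary w @ 3 # nums v @ 4 # vote_words V"
  by (simp add: vote_words_def enc_number_def enc_numbers_def nums_def)

lemma vote_words_append [simp]: "vote_words (U @ V) = vote_words U @ vote_words V"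
  by (simp add: vote_words_def)

lemma zero_notin_vote_words [simp]: "0 \<notin> set (vote_words V)"
  by (induction V) auto

lemma length_le_vote_words: "length V \<le> length (vote_words V)"
  by (induction V) auto

lemma peek_vote_words: "peek (vote_words (x # V) @ xs) \<noteq> 4"
  by (cases x) simp

text \<open>
  \<open>hit d v c\<close> is positive iff \<open>c\<close> gets a point from a vote \<open>v\<close> that leaves \<open>d\<close> candidates unranked.
\<close>

locale scoring_program =
  fixes bit :: prog and hit :: "nat \<Rightarrow> nat list \<Rightarrow> nat \<Rightarrow> nat"
  assumes run_bit: "\<And>n s v c d. s rVote = nums v \<Longrightarrow> v \<noteq> [] \<Longrightarrow> s rCand = binary c \<Longrightarrow>
      s rRoom = replicate d 1 \<Longrightarrow> s rTmp = [] \<Longrightarrow> s rItem = [] \<Longrightarrow> s rFlag = [] \<Longrightarrow>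
      length (nums v) \<le> n \<Longrightarrow> length (binary c) \<le> n \<Longrightarrow> d \<le> n \<Longrightarrow>
      run n bit s = s(rVote := [], rRoom := [], rFlag := replicate (hit d v c) 1)"
    and hit_le: "\<And>d v c. v \<noteq> [] \<Longrightarrow> hit d v c \<le> length v"
    and wf_bit: "wf_prog 25 25 bit"
begin

definition points :: "nat \<Rightarrow> (nat \<times> nat list) list \<Rightarrow> nat \<Rightarrow> nat" where
  "points m V c = (\<Sum>(w, v)\<leftarrow>V. if 0 < hit (m - length v) v c then w else 0)"

lemma points_Nil [simp]: "points m [] c = 0"
  by (simp add: points_def)

lemma points_append [simp]: "points m (U @ V) c = points m U c + points m V c"
  by (simp add: points_def)

lemma points_single [simp]:
  "points m [(w, v)] c = (if 0 < hit (m - length v) v c then w else 0)"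
  by (simp add: points_def)

lemma points_le: "points m V c \<le> (\<Sum>(w, v)\<leftarrow>V. w)"
  unfolding points_def by (rule sum_list_mono) auto

definition vote_step :: prog where
  "vote_step = split 3 rStream rWeight ;; split 4 rStream rVote ;; subtract ;; bit ;;
     Cond (\<lambda>h. h rFlag \<noteq> 0) add (clear rWeight) ;; clear rFlag"

text \<open>The loop stops at a 4 instead of the end of the stack, because the weights of the
  manipulators follow on the same stream. A vote begins with a digit or a 3, never with a 4.\<close>

definition score_prog :: prog where
  "score_prog = While (\<lambda>h. h rStream \<noteq> 4) vote_step"

lemma run_vote_step:
  assumes s: "s rStream = binary w @ 3 # nums v @ 4 # xs" "s rCand = binary c"
    "s rTally = replicate m 1" "s rSum = binary a"
    "s rWeight = []" "s rVote = []" "s rFlag = []" "s rRoom = []" "s rVote2 = []" "s rCarry = []"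
    "s rItem = []" "s rTmp = []"
    and n: "length (s rStream) \<le> n" "length (binary c) \<le> n" "m \<le> n" "a + w < 2 ^ n"
    and xs: "0 \<notin> set xs" and v: "v \<noteq> []"
  shows "run n vote_step s = s(rStream := xs, rSum := binary (a + points m [(w, v)] c))"
proof -
  let ?s1 = "s(rStream := xs, rWeight := binary w, rVote := nums v)"
  let ?j = "hit (m - length v) v c"
  let ?s2 = "s(rStream := xs, rWeight := binary w, rFlag := replicate ?j 1)"
  have len: "length (binary w) \<le> n" "length (nums v) \<le> n" "length xs \<le> n"
    "Suc (length (nums v) + length xs) \<le> n" "Suc (length (binary w) + Suc (length (nums v) + length xs)) \<le> n"
    using n(1) s(1) by auto
  \<comment> \<open>The flag holds up to \<open>length v\<close> symbols, few enough for
    \<open>clear\<close> to remove them.\<close>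
  have j: "?j \<le> n" using hit_le[OF v] length_le_nums[of v] len by (meson order_trans)
  have 1: "run n (split 3 rStream rWeight ;; split 4 rStream rVote) s = ?s1"
    using s len xs by (simp add: run_split fun_upd_twist)
  have 2: "run n (subtract ;; bit) ?s1 = ?s2"
  proof -
    have "run n subtract ?s1 = ?s1(rRoom := replicate (m - length v) 1)"
      using s len n by (intro run_subtract) auto
    moreover have "run n bit (?s1(rRoom := replicate (m - length v) 1)) =
        ?s1(rRoom := replicate (m - length v) 1, rVote := [], rRoom := [], rFlag := replicate ?j 1)"
      using s len n v by (intro run_bit) auto
    moreover have "\<dots> = ?s2" using s by (auto simp: fun_eq_iff)
    ultimately show ?thesis by simp
  qed
  have 3: "run n (Cond (\<lambda>h. h rFlag \<noteq> 0) add (clear rWeight)) ?s2 =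
      s(rStream := xs, rSum := binary (a + points m [(w, v)] c), rFlag := replicate ?j 1)"
  proof (cases "?j = 0")
    case True
    then show ?thesis using s len by (auto simp: run_clear fun_eq_iff)
  next
    case False
    have "run n add ?s2 = ?s2(rSum := binary (a + w), rWeight := [])"
      using s length_binary_le[OF n(4)] by (intro run_add) auto
    then show ?thesis using False s by (auto simp: peek_replicate fun_eq_iff)
  qed
  have 4: "run n (clear rFlag) (s(rStream := xs, rSum := binary (a + points m [(w, v)] c),
      rFlag := replicate ?j 1)) = s(rStream := xs, rSum := binary (a + points m [(w, v)] c))"
    using s j by (auto simp: run_clear fun_eq_iff)
  show ?thesis
    using 1 2 3 4 unfolding vote_step_def by simp
qed

lemma run_score_prog:
  assumes s: "s rStream = vote_words V @ 4 # xs" "s rCand = binary c"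
    "s rTally = replicate m 1" "s rSum = binary a"
    "s rWeight = []" "s rVote = []" "s rFlag = []" "s rRoom = []" "s rVote2 = []" "s rCarry = []"
    "s rItem = []" "s rTmp = []"
    and n: "length (s rStream) \<le> n" "length (binary c) \<le> n" "m \<le> n"
      "a + (\<Sum>(w, v)\<leftarrow>V. w) < 2 ^ n"
    and xs: "0 \<notin> set xs" and V: "\<forall>(w, v)\<in>set V. v \<noteq> []"
  shows "run n score_prog s = s(rStream := 4 # xs, rSum := binary (a + points m V c))"
  unfolding score_prog_def
proof (rule run_While_list[where xs = V and
      \<sigma> = "\<lambda>ys zs. s(rStream := vote_words zs @ 4 # xs, rSum := binary (a + points m ys c))"])
  fix ys x zs assume V': "V = ys @ x # zs"
  obtain w v where x: "x = (w, v)" by (cases x)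
  let ?s = "s(rStream := vote_words (x # zs) @ 4 # xs, rSum := binary (a + points m ys c))"
  \<comment> \<open>Every partial sum is at most the start value plus the total weight, hence has at
    most \<open>n\<close> digits, as \<open>add\<close> requires.\<close>
  have "a + points m ys c + w < 2 ^ n"
    using n(4) V' x points_le[of m ys c] by simp
  then have "run n vote_step ?s =
      ?s(rStream := vote_words zs @ 4 # xs, rSum := binary (a + points m ys c + points m [(w, v)] c))"
    using s n V V' xs x by (intro run_vote_step) auto
  then show "peek (?s rStream) \<noteq> 4 \<and> run n vote_step ?s =
      s(rStream := vote_words zs @ 4 # xs, rSum := binary (a + points m (ys @ [x]) c))"
    using peek_vote_words by (simp add: x add.assoc)
qed (use s n length_le_vote_words[of V] in \<open>auto simp: fun_eq_iff\<close>)

end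

section \<open>Who gets a point under each rule\<close>

definition plurality_bit :: prog where
  "plurality_bit =
     Pop rRoom ;;
     When (\<lambda>h. h rRoom = 0) (split 3 rVote rItem ;; test_eq rCand rItem rFlag) ;;
     clear rVote ;; clear rRoom"

text \<open>The top of an incomplete vote of length \<open>k\<close> is scored as position
  \<open>m - k\<close>, which is 1 only if exactly one candidate is unranked; in a complete vote it
  is position 1 anyway. In the program the condition \<open>d \<le> 1\<close> is emptiness of
  \<open>rRoom\<close> after one pop.\<close>

definition plurality_hit :: "nat \<Rightarrow> nat list \<Rightarrow> nat \<Rightarrow> nat" where
  "plurality_hit d v c = (if d \<le> 1 \<and> hd v = c then 1 else 0)"

text \<open>Rounding down puts the last candidate of an incomplete vote at position
  \<open>m - 1\<close>, so all ranked candidates get the point. Only the last candidate of a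
  complete vote is left out, recognised by both \<open>rVote\<close> and \<open>rRoom\<close> being
  empty.\<close>

definition veto_bit :: prog where
  "veto_bit =
     While (\<lambda>h. h rVote \<noteq> 0)
       (split 3 rVote rItem ;;
        Cond (\<lambda>h. h rVote \<noteq> 0 \<or> h rRoom \<noteq> 0) (test_eq rCand rItem rFlag) (clear rItem)) ;;
     clear rRoom"

definition veto_hit :: "nat \<Rightarrow> nat list \<Rightarrow> nat \<Rightarrow> nat" where
  "veto_hit d v c = count_list (if d = 0 then butlast v else v) c"

lemmas wf_defs = rev_onto_def clear_def copy_def split_def test_eq_def count_item_def set_bad_def
  check_vote_def add_step_def add_def compare_step_def compare_def tally_def subtract_def digit_def

lemma zero_notin_replicate [simp]: "0 \<notin> set (replicate k (Suc 0))"
  by simp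

lemma run_plurality_bit:
  assumes s: "s rVote = nums v" "v \<noteq> []" "s rCand = binary c" "s rRoom = replicate d 1"
    "s rTmp = []" "s rItem = []" "s rFlag = []"
    and n: "length (nums v) \<le> n" "length (binary c) \<le> n" "d \<le> n"
  shows "run n plurality_bit s = s(rVote := [], rRoom := [], rFlag := replicate (plurality_hit d v c) 1)"
proof -
  obtain x v' where v: "v = x # v'" using s(2) by (cases v) auto
  have tl: "tl (replicate d (1 :: nat)) = replicate (d - 1) 1" by (cases d) auto
  have len: "length (binary x) \<le> n" "Suc (length (binary x) + length (nums v')) \<le> n"
    "length (nums v') \<le> n" "d - Suc 0 \<le> n"
    using n v by auto
  show ?thesis
  proof (cases "d \<le> 1")
    case True
    then have "d - 1 = 0" by simp
    then show ?thesis unfolding plurality_bit_def plurality_hit_def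
      using s n v tl len True
      by (simp add: run_split run_test_eq run_clear) (auto simp: fun_eq_iff)
  next
    case False
    then show ?thesis unfolding plurality_bit_def plurality_hit_def
      using s n v tl len
      by (simp add: run_clear peek_replicate) (auto simp: fun_eq_iff)
  qed
qed

interpretation plurality: scoring_program plurality_bit plurality_hit
proof
  show "wf_prog 25 25 plurality_bit"
    by (simp add: plurality_bit_def wf_defs)
  show "plurality_hit d v c \<le> length v" if "v \<noteq> []" for d v c
    using that by (cases v) (auto simp: plurality_hit_def)
qed (rule run_plurality_bit)

lemma run_veto_bit:
  assumes s: "s rVote = nums v" "v \<noteq> []" "s rCand = binary c" "s rRoom = replicate d 1"
    "s rTmp = []" "s rItem = []" "s rFlag = []"
    and n: "length (nums v) \<le> n" "length (binary c) \<le> n" "d \<le> n"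
  shows "run n veto_bit s = s(rVote := [], rRoom := [], rFlag := replicate (veto_hit d v c) 1)"
proof -
  let ?body = "split 3 rVote rItem ;;
        Cond (\<lambda>h. h rVote \<noteq> 0 \<or> h rRoom \<noteq> 0) (test_eq rCand rItem rFlag) (clear rItem)"
  \<comment> \<open>Whether the current candidate is the last one shows only when nothing is left,
    so \<open>butlast\<close> enters the invariant at the end of the traversal.\<close>
  let ?cnt = "\<lambda>ys zs. count_list (if zs = [] \<and> d = 0 then butlast ys else ys) c"
  have "run n (While (\<lambda>h. h rVote \<noteq> 0) ?body) s =
      s(rVote := [], rFlag := replicate (veto_hit d v c) 1)"
  proof (rule run_While_list[where xs = v and
        \<sigma> = "\<lambda>ys zs. s(rVote := nums zs, rFlag := replicate (?cnt ys zs) 1)"])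
    fix ys x zs assume v: "v = ys @ x # zs"
    let ?s = "s(rVote := nums (x # zs), rFlag := replicate (?cnt ys (x # zs)) 1)"
    have len: "length (binary x) \<le> n" "Suc (length (binary x) + length (nums zs)) \<le> n"
      "length (nums zs) \<le> n"
      using n v by auto
    show "peek (?s rVote) \<noteq> 0 \<and> run n ?body ?s =
        s(rVote := nums zs, rFlag := replicate (?cnt (ys @ [x]) zs) 1)"
      using s n len
      by (simp add: run_split run_test_eq run_clear peek_eq_0 peek_replicate) (auto simp: fun_eq_iff)
  qed (use s n length_le_nums[of v] in \<open>auto simp: fun_eq_iff veto_hit_def\<close>)
  then show ?thesis unfolding veto_bit_def
    using s n by (simp add: run_clear) (auto simp: fun_eq_iff)
qed

interpretation veto: scoring_program veto_bit veto_hit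
proof
  show "wf_prog 25 25 veto_bit"
    by (simp add: veto_bit_def wf_defs)
  show "veto_hit d v c \<le> length v" if "v \<noteq> []" for d v c
  proof -
    have "count_list (butlast v) c \<le> length v" "count_list v c \<le> length v"
      using count_le_length[of "butlast v" c] count_le_length[of v c] by auto
    then show ?thesis by (simp add: veto_hit_def)
  qed
qed (rule run_veto_bit)

section \<open>The decision program\<close>

definition idle :: "store \<Rightarrow> bool" where
  "idle s \<longleftrightarrow> (\<forall>i\<in>{rTmp, rStream, rWeight, rVote, rTodo, rElem, rList, rItem, rFlag, rSum, rBound2,
     rRoom, rCarry, rVote2, rCand}. s i = [])"

text \<open>The candidate list is checked as if it were a vote over itself: membership is then
  trivial and distinctness remains.\<close>

definition check_candidates :: prog where
  "check_candidates = copy rCands rVote ;; check_vote ;; clear rVote ;;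
     copy rPref rElem ;; copy rCands rList ;; count_item ;; When (\<lambda>h. h rFlag = 0) set_bad ;;
     clear rFlag ;; clear rElem"

lemma run_check_candidates:
  assumes s: "idle s" "s rCands = nums C" "s rPref = binary p" "s rBad = flag b"
    and n: "length (nums C) \<le> n" "length (binary p) \<le> n"
  shows "run n check_candidates s = s(rBad := flag (b \<or> \<not> distinct C \<or> p \<notin> set C))"
proof -
  let ?s1 = "s(rBad := flag (b \<or> \<not> distinct C))"
  have "run n (copy rCands rVote) s = s(rVote := nums C)"
    using s n by (simp add: idle_def run_copy)
  moreover have "run n check_vote (s(rVote := nums C)) =
      s(rVote := nums C, rBad := flag (b \<or> \<not> (distinct C \<and> set C \<subseteq> set C)))"
    using s n by (intro run_check_vote) (auto simp: idle_def)
  moreover have "run n (clear rVote) (s(rVote := nums C, rBad := flag (b \<or> \<not> distinct C))) = ?s1"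
    using s n by (auto simp: idle_def run_clear fun_eq_iff)
  ultimately have 1: "run n (copy rCands rVote ;; check_vote ;; clear rVote) s = ?s1" by simp
  have "count_list C p \<le> n" using count_list_length_nums[of C p] n(1) by linarith
  then have 2: "run n (copy rPref rElem ;; copy rCands rList ;; count_item ;; When (\<lambda>h. h rFlag = 0) set_bad ;;
     clear rFlag ;; clear rElem) ?s1 = s(rBad := flag (b \<or> \<not> distinct C \<or> p \<notin> set C))"
    using s n unfolding idle_def
    by (simp add: run_copy run_count_item[where ks = C and k = p])
      (auto simp: run_set_bad run_clear peek_replicate fun_eq_iff count_list_0_iff
        intro!: arg_cong[of _ _ flag])
  show ?thesis using 1 2 unfolding check_candidates_def by simp
qed

definition check_votes :: prog where
  "check_votes = copy rInp rStream ;;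
     While (\<lambda>h. h rStream \<noteq> 4)
       (split 3 rStream rWeight ;; clear rWeight ;; split 4 rStream rVote ;;
        When (\<lambda>h. h rVote = 0) set_bad ;; check_vote ;; clear rVote) ;;
     clear rStream"

lemma run_check_votes:
  assumes s: "idle s" "s rInp = vote_words V @ 4 # xs" "s rCands = nums C" "s rBad = flag b"
    and n: "length (s rInp) \<le> n" "length (nums C) \<le> n" and xs: "0 \<notin> set xs"
  shows "run n check_votes s =
    s(rBad := flag (b \<or> \<not> (\<forall>(w, v)\<in>set V. top_truncated_vote (set C) v)))"
proof -
  let ?body = "split 3 rStream rWeight ;; clear rWeight ;; split 4 rStream rVote ;;
        When (\<lambda>h. h rVote = 0) set_bad ;; check_vote ;; clear rVote"
  define bad where "bad x \<longleftrightarrow> \<not> top_truncated_vote (set C) (snd x)" for x :: "nat \<times> nat list"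
  have "run n (While (\<lambda>h. h rStream \<noteq> 4) ?body) (s(rStream := vote_words V @ 4 # xs)) =
      s(rStream := 4 # xs, rBad := flag (b \<or> (\<exists>x\<in>set V. bad x)))"
  proof (rule run_While_list[where xs = V and
        \<sigma> = "\<lambda>ys zs. s(rStream := vote_words zs @ 4 # xs, rBad := flag (b \<or> (\<exists>x\<in>set ys. bad x)))"])
    fix ys x zs assume V: "V = ys @ x # zs"
    obtain w v where x: "x = (w, v)" by (cases x)
    define b1 where "b1 \<longleftrightarrow> b \<or> (\<exists>x\<in>set ys. bad x)"
    define r where "r = vote_words zs @ 4 # xs"
    have len: "length (binary w) \<le> n" "length (nums v) \<le> n" "length r \<le> n"
      "Suc (length (nums v) + length r) \<le> n" "Suc (length (binary w) + Suc (length (nums v) + length r)) \<le> n"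
      using n(1) s(2) V x by (auto simp: r_def)
    have r: "0 \<notin> set r" using xs by (simp add: r_def)
    let ?s = "s(rStream := vote_words (x # zs) @ 4 # xs, rBad := flag b1)"
    have x_words: "vote_words (x # zs) @ 4 # xs = binary w @ 3 # nums v @ 4 # r" by (simp add: x r_def)
    let ?s1 = "s(rStream := r, rVote := nums v, rBad := flag b1)"
    let ?s2 = "s(rStream := r, rVote := nums v, rBad := flag (b1 \<or> v = []))"
    let ?s3 = "s(rStream := r, rVote := nums v, rBad := flag (b1 \<or> bad x))"
    have 1: "run n (split 3 rStream rWeight ;; clear rWeight ;; split 4 rStream rVote) ?s = ?s1"
      unfolding x_words using s len r
      by (simp add: idle_def run_split run_clear) (auto simp: fun_eq_iff)
    have 2: "run n (When (\<lambda>h. h rVote = 0) set_bad) ?s1 = ?s2"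
      using run_set_bad[of ?s1 b1 n] by (auto simp: peek_eq_0 fun_eq_iff)
    have "run n check_vote ?s2 =
        ?s2(rBad := flag ((b1 \<or> v = []) \<or> \<not> (distinct v \<and> set v \<subseteq> set C)))"
      using s n len by (intro run_check_vote) (auto simp: idle_def)
    moreover have "(b1 \<or> v = []) \<or> \<not> (distinct v \<and> set v \<subseteq> set C) \<longleftrightarrow> b1 \<or> bad x"
      by (auto simp: bad_def x top_truncated_vote_def)
    ultimately have 3: "run n check_vote ?s2 = ?s3" by simp
    have 4: "run n (clear rVote) ?s3 = s(rStream := r, rBad := flag (b1 \<or> bad x))"
      using s len by (auto simp: idle_def run_clear fun_eq_iff)
    have "run n ?body ?s = s(rStream := r, rBad := flag (b1 \<or> bad x))"
      using 1 2 3 4 by simp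
    then show "peek (?s rStream) \<noteq> 4 \<and> run n ?body ?s =
        s(rStream := vote_words zs @ 4 # xs, rBad := flag (b \<or> (\<exists>x\<in>set (ys @ [x]). bad x)))"
      using peek_vote_words by (simp add: b1_def r_def disj_ac)
  qed (use s n length_le_vote_words[of V] in \<open>auto simp: idle_def fun_eq_iff\<close>)
  moreover have "(\<exists>x\<in>set V. bad x) \<longleftrightarrow> \<not> (\<forall>(w, v)\<in>set V. top_truncated_vote (set C) v)"
    by (fastforce simp: bad_def)
  ultimately show ?thesis unfolding check_votes_def
    using s n xs by (simp add: idle_def run_copy run_clear) (auto simp: fun_eq_iff)
qed

context scoring_program
begin

text \<open>Once the 4 behind the votes is popped, the stream holds the manipulators' weights, which
  are added to the same sum. Moving the sum twice restores the order of its digits.\<close>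

definition compute_bound :: prog where
  "compute_bound = copy rPref rCand ;; copy rInp rStream ;; score_prog ;; Pop rStream ;;
     While (\<lambda>h. h rStream \<noteq> 4) (split 3 rStream rWeight ;; add) ;;
     clear rStream ;; clear rCand ;; rev_onto rSum rTmp ;; rev_onto rTmp rBound"

lemma run_compute_bound:
  assumes s: "idle s" "s rInp = vote_words V @ 4 # nums W @ [4]" "s rPref = binary p"
    "s rTally = replicate m 1" "s rBound = []"
    and n: "length (s rInp) \<le> n" "length (binary p) \<le> n" "m \<le> n"
      "(\<Sum>(w, v)\<leftarrow>V. w) + sum_list W < 2 ^ n"
    and V: "\<forall>(w, v)\<in>set V. v \<noteq> []"
  shows "run n compute_bound s = s(rBound := binary (points m V p + sum_list W))"
proof -
  let ?s1 = "s(rCand := binary p, rStream := vote_words V @ 4 # nums W @ [4])"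
  let ?a = "points m V p"
  have 1: "run n (copy rPref rCand ;; copy rInp rStream) s = ?s1"
    using s n by (simp add: idle_def run_copy)
  have 2: "run n score_prog ?s1 = ?s1(rStream := 4 # nums W @ [4], rSum := binary (0 + ?a))"
    using s n V by (intro run_score_prog) (auto simp: idle_def)
  let ?s2 = "s(rCand := binary p, rSum := binary ?a, rStream := nums W @ [4])"
  let ?s3 = "s(rCand := binary p, rSum := binary (?a + sum_list W), rStream := [4])"
  have 3: "run n (While (\<lambda>h. h rStream \<noteq> 4) (split 3 rStream rWeight ;; add)) ?s2 = ?s3"
  proof (rule run_While_list[where xs = W and
        \<sigma> = "\<lambda>ys zs. s(rCand := binary p, rSum := binary (?a + sum_list ys), rStream := nums zs @ [4])"])
    fix ys x zs assume W: "W = ys @ x # zs"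
    have len: "length (binary x) \<le> n" "Suc (Suc (length (binary x) + length (nums zs))) \<le> n"
      using n s(2) W by auto
    let ?t = "s(rCand := binary p, rSum := binary (?a + sum_list ys), rStream := nums (x # zs) @ [4])"
    let ?t1 = "s(rCand := binary p, rSum := binary (?a + sum_list ys), rStream := nums zs @ [4], rWeight := binary x)"
    have "run n (split 3 rStream rWeight) ?t = ?t1"
      using s len by (simp add: idle_def run_split fun_upd_twist)
    moreover have "?a + sum_list ys + x < 2 ^ n"
      using n(4) W points_le[of m V p] by simp
    then have "run n add ?t1 = ?t1(rSum := binary (?a + sum_list ys + x), rWeight := [])"
      using s length_binary_le by (intro run_add) (auto simp: idle_def)
    moreover have "\<dots> = s(rCand := binary p, rSum := binary (?a + sum_list (ys @ [x])), rStream := nums zs @ [4])"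
      using s by (auto simp: idle_def fun_eq_iff add.assoc)
    ultimately show "peek (?t rStream) \<noteq> 4 \<and> run n (split 3 rStream rWeight ;; add) ?t =
        s(rCand := binary p, rSum := binary (?a + sum_list (ys @ [x])), rStream := nums zs @ [4])"
      by simp
  qed (use s n length_le_nums[of W] in \<open>auto simp: fun_eq_iff\<close>)
  have "?a + sum_list W < 2 ^ n" using n(4) points_le[of m V p] by simp
  then have 4: "run n (clear rStream ;; clear rCand ;; rev_onto rSum rTmp ;; rev_onto rTmp rBound) ?s3 =
      s(rBound := binary (?a + sum_list W))"
    using s n length_binary_le
    by (simp add: idle_def run_clear run_rev_onto) (auto simp: fun_eq_iff)
  then show ?thesis unfolding compute_bound_def using 1 2 3 4 by simp
qed

definition compare_all :: prog where
  "compare_all = copy rCands rTodo ;;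
     While (\<lambda>h. h rTodo \<noteq> 0)
       (split 3 rTodo rCand ;; copy rInp rStream ;; score_prog ;; clear rStream ;; clear rCand ;;
        copy rBound rBound2 ;; compare ;; When (\<lambda>h. h rFlag \<noteq> 0) set_bad ;; clear rFlag)"

lemma run_compare_all:
  assumes s: "idle s" "s rInp = vote_words V @ 4 # xs" "s rCands = nums C"
    "s rTally = replicate m 1" "s rBound = binary B" "s rBad = flag b"
    and n: "length (s rInp) \<le> n" "length (nums C) \<le> n" "m \<le> n" "B < 2 ^ n"
      "(\<Sum>(w, v)\<leftarrow>V. w) < 2 ^ n"
    and xs: "0 \<notin> set xs" and V: "\<forall>(w, v)\<in>set V. v \<noteq> []"
  shows "run n compare_all s = s(rBad := flag (b \<or> (\<exists>c\<in>set C. B < points m V c)))"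
proof -
  let ?body = "split 3 rTodo rCand ;; copy rInp rStream ;; score_prog ;; clear rStream ;; clear rCand ;;
        copy rBound rBound2 ;; compare ;; When (\<lambda>h. h rFlag \<noteq> 0) set_bad ;; clear rFlag"
  have "run n (While (\<lambda>h. h rTodo \<noteq> 0) ?body) (s(rTodo := nums C)) =
      s(rBad := flag (b \<or> (\<exists>c\<in>set C. B < points m V c)))"
  proof (rule run_While_list[where xs = C and
        \<sigma> = "\<lambda>ys zs. s(rTodo := nums zs, rBad := flag (b \<or> (\<exists>c\<in>set ys. B < points m V c)))"])
    fix ys c zs assume C: "C = ys @ c # zs"
    define b1 where "b1 \<longleftrightarrow> b \<or> (\<exists>c\<in>set ys. B < points m V c)"
    let ?a = "points m V c"
    have len: "length (binary c) \<le> n" "Suc (length (binary c) + length (nums zs)) \<le> n"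
      "Suc (length (vote_words V) + length xs) \<le> n" "length xs < n"
      using n s(2) C by auto
    have "?a < 2 ^ n" using points_le[of m V c] n(5) by linarith
    then have bin: "length (binary ?a) \<le> n" "length (binary B) \<le> n"
      using length_binary_le n(4) by blast+
    let ?s = "s(rTodo := nums (c # zs), rBad := flag b1)"
    let ?u = "s(rTodo := nums zs, rBad := flag b1)"
    let ?s1 = "?u(rCand := binary c, rStream := vote_words V @ 4 # xs)"
    let ?s2 = "?u(rCand := binary c, rStream := 4 # xs, rSum := binary ?a)"
    let ?s3 = "?u(rSum := binary ?a, rBound2 := binary B)"
    let ?s4 = "?u(rFlag := flag (B < ?a))"
    have 1: "run n (split 3 rTodo rCand ;; copy rInp rStream) ?s = ?s1"
      using s len xs by (simp add: idle_def run_split run_copy) (auto simp: fun_eq_iff)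
    have "run n score_prog ?s1 = ?s1(rStream := 4 # xs, rSum := binary (0 + ?a))"
      using s n len V xs by (intro run_score_prog) (auto simp: idle_def)
    then have 2: "run n score_prog ?s1 = ?s2" by simp
    have 3: "run n (clear rStream ;; clear rCand ;; copy rBound rBound2) ?s2 = ?s3"
      using s len xs bin by (simp add: idle_def run_clear run_copy) (auto simp: fun_eq_iff)
    have "run n compare ?s3 = ?s3(rSum := [], rBound2 := [], rFlag := flag (B < ?a))"
      using s bin by (intro run_compare) (auto simp: idle_def)
    moreover have "\<dots> = ?s4" using s by (auto simp: idle_def fun_eq_iff)
    ultimately have 4: "run n compare ?s3 = ?s4" by simp
    have 5: "run n (When (\<lambda>h. h rFlag \<noteq> 0) set_bad ;; clear rFlag) ?s4 =
        s(rTodo := nums zs, rBad := flag (b1 \<or> B < ?a))"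
      using run_set_bad[of ?s4 b1 n] s len
      by (cases "B < ?a") (auto simp: idle_def run_clear fun_eq_iff flag_def)
    have "run n ?body ?s = s(rTodo := nums zs, rBad := flag (b1 \<or> B < ?a))"
      using 1 2 3 4 5 by simp
    then show "peek (?s rTodo) \<noteq> 0 \<and> run n ?body ?s =
        s(rTodo := nums zs, rBad := flag (b \<or> (\<exists>c\<in>set (ys @ [c]). B < points m V c)))"
      by (simp add: b1_def disj_ac)
  qed (use s n length_le_nums[of C] in \<open>auto simp: idle_def fun_eq_iff\<close>)
  then show ?thesis unfolding compare_all_def
    using s n by (simp add: idle_def run_copy)
qed

text \<open>Scores are computed only for valid instances, because the scoring procedures are
  specified for non-empty votes.\<close>

definition decide :: prog where
  "decide = split 3 rInp rPref ;; split 4 rInp rCands ;; tally ;; check_candidates ;; check_votes ;;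
     When (\<lambda>h. h rBad = 0)
       (compute_bound ;; compare_all ;; When (\<lambda>h. h rBad = 0) (Push rOut (\<lambda>_. 1)))"

definition winnable :: "cwcm \<Rightarrow> bool" where
  "winnable I \<longleftrightarrow> (\<forall>c\<in>set (candidates I).
     points (length (candidates I)) (fixed_votes I) c \<le>
     points (length (candidates I)) (fixed_votes I) (preferred I) + sum_list (manipulator_weights I))"

text \<open>From \<open>a + b < (a + 1) * (b + 1)\<close>. It turns the lengths of concatenated
  numerals into a bound on the sum of their values.\<close>

lemma less_two_power_add: "a < 2 ^ i \<Longrightarrow> b < 2 ^ j \<Longrightarrow> a + b < 2 ^ (i + j)" for a b :: nat
proof -
  assume a: "a < 2 ^ i" and b: "b < 2 ^ j"
  have "(a + 1) * (b + 1) \<le> 2 ^ i * 2 ^ j" using a b by (intro mult_le_mono) auto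
  then show ?thesis by (simp add: power_add)
qed

lemma less_two_power_binary: "k < 2 ^ length (binary k)"
proof (induction k rule: less_induct)
  case (less k)
  show ?case
  proof (cases "k = 0")
    case False
    then have "k div 2 < 2 ^ length (binary (k div 2))" using less by simp
    then show ?thesis using False by (subst length_binary) simp
  qed simp
qed

lemma sum_list_less_two_power: "sum_list W < 2 ^ length (nums W)"
proof (induction W)
  case (Cons k W)
  have "k + sum_list W < 2 ^ (length (binary k) + length (nums W))"
    using less_two_power_binary Cons by (intro less_two_power_add) auto
  also have "\<dots> \<le> 2 ^ length (nums (k # W))" by simp
  finally show ?case by simp
qed simp

lemma sum_votes_less_two_power: "(\<Sum>(w, v)\<leftarrow>V. w) < 2 ^ length (vote_words V)"
proof (induction V)
  case (Cons x V)
  obtain k v where x: "x = (k, v)" by (cases x)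
  have "k + (\<Sum>(w, v)\<leftarrow>V. w) < 2 ^ (length (binary k) + length (vote_words V))"
    using less_two_power_binary Cons by (intro less_two_power_add) auto
  also have "\<dots> \<le> 2 ^ length (vote_words (x # V))" by (intro power_increasing) (auto simp: x)
  finally show ?case by (simp add: x)
qed simp

lemma encode_eq: "encode I = binary (preferred I) @ 3 # nums (candidates I) @ 4 #
    vote_words (fixed_votes I) @ 4 # nums (manipulator_weights I) @ [4]"
  by (simp add: encode_def enc_number_def enc_numbers_def enc_votes_def nums_def vote_words_def)

lemma run_decide:
  assumes s: "idle s" "s rInp = encode I" "s rPref = []" "s rCands = []" "s rTally = []"
    "s rBad = []" "s rBound = []" "s rOut = []"
    and n: "n = length (encode I)"
  shows "peek (run n decide s rOut) = 1 \<longleftrightarrow> cwcm_instance I \<and> winnable I"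
proof -
  obtain p C V W where I: "I = \<lparr>preferred = p, candidates = C, fixed_votes = V, manipulator_weights = W\<rparr>"
    by (cases I) auto
  let ?r = "vote_words V @ 4 # nums W @ [4]"
  have enc: "encode I = binary p @ 3 # nums C @ 4 # ?r" by (simp add: encode_eq I)
  have len: "Suc (length (binary p) + Suc (length (nums C) + length ?r)) \<le> n"
    using n enc by simp
  have "length C \<le> n" using len length_le_nums[of C] by simp
  have "(\<Sum>(w, v)\<leftarrow>V. w) + sum_list W < 2 ^ (length (vote_words V) + length (nums W))"
    by (intro less_two_power_add sum_votes_less_two_power sum_list_less_two_power)
  also have "\<dots> \<le> 2 ^ n" using len by (intro power_increasing) auto
  finally have sum: "(\<Sum>(w, v)\<leftarrow>V. w) + sum_list W < 2 ^ n" .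
  let ?s0 = "s(rInp := ?r, rPref := binary p, rCands := nums C)"
  let ?s1 = "?s0(rTally := replicate (length C) 1)"
  have idle: "idle ?s1" using s by (simp add: idle_def)
  have 1: "run n (split 3 rInp rPref ;; split 4 rInp rCands) s = ?s0"
    using s len unfolding enc
    by (simp add: idle_def run_split) (auto simp: fun_eq_iff)
  have 2: "run n tally ?s0 = ?s1"
    using s len by (intro run_tally) (auto simp: idle_def)
  let ?b1 = "\<not> distinct C \<or> p \<notin> set C"
  let ?b2 = "?b1 \<or> \<not> (\<forall>(w, v)\<in>set V. top_truncated_vote (set C) v)"
  have 3: "run n check_candidates ?s1 = ?s1(rBad := flag (False \<or> ?b1))"
    using s len idle by (intro run_check_candidates) (auto simp: flag_def)
  have 4: "run n check_votes (?s1(rBad := flag ?b1)) = ?s1(rBad := flag ?b1, rBad := flag ?b2)"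
    using s len idle by (intro run_check_votes) (auto simp: idle_def)
  have inst: "cwcm_instance I \<longleftrightarrow> \<not> ?b2" by (auto simp: cwcm_instance_def I)
  let ?rest = "compute_bound ;; compare_all ;; When (\<lambda>h. h rBad = 0) (Push rOut (\<lambda>_. 1))"
  have decide: "run n decide s = run n (When (\<lambda>h. h rBad = 0) ?rest) (?s1(rBad := flag ?b2))"
    unfolding decide_def using 1 2 3 4 by simp
  show ?thesis
  proof (cases "cwcm_instance I")
    case False
    then have "run n decide s = ?s1(rBad := flag True)"
      unfolding decide using inst by simp
    then show ?thesis using False s by simp
  next
    case True
    have V: "\<forall>(w, v)\<in>set V. v \<noteq> []"
      using True by (auto simp: cwcm_instance_def I top_truncated_vote_def)
    let ?s2 = "?s1(rBad := flag False)"
    let ?B = "points (length C) V p + sum_list W"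
    have 5: "run n compute_bound ?s2 = ?s2(rBound := binary ?B)"
      using s len idle sum V \<open>length C \<le> n\<close> by (intro run_compute_bound) (auto simp: idle_def)
    let ?b3 = "\<exists>c\<in>set C. ?B < points (length C) V c"
    have "?B < 2 ^ n" using sum points_le[of "length C" V p] by linarith
    then have 6: "run n compare_all (?s2(rBound := binary ?B)) =
        ?s2(rBound := binary ?B, rBad := flag (False \<or> ?b3))"
      using s len idle sum V \<open>length C \<le> n\<close> by (intro run_compare_all) (auto simp: idle_def)
    have "run n decide s = run n (When (\<lambda>h. h rBad = 0) (Push rOut (\<lambda>_. 1)))
        (?s2(rBound := binary ?B, rBad := flag ?b3))"
      unfolding decide using True inst 5 6 by simp
    moreover have "winnable I \<longleftrightarrow> \<not> ?b3" by (auto simp: winnable_def I not_less)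
    ultimately show ?thesis using True s by simp
  qed
qed

text \<open>The new state passes through \<open>rState2\<close>, since a symbol pushed on
  \<open>rState\<close> must not depend on that stack.\<close>

definition main :: prog where
  "main = rev_onto rRaw rInp ;; copy rInp rStream ;;
     While (\<lambda>h. h rStream \<noteq> 0)
       (Push rState2 (\<lambda>h. delta (h rState) (h rStream)) ;; Pop rState ;;
        Push rState (\<lambda>h. h rState2) ;; Pop rState2 ;; Pop rStream) ;;
     When (\<lambda>h. h rState = 15) decide"

lemma run_main:
  assumes s: "s rRaw = rev w" "\<And>i. i < 25 \<Longrightarrow> i \<noteq> rRaw \<Longrightarrow> s i = []" and w: "0 \<notin> set w"
    and n: "n = length w"
  shows "peek (run n main s rOut) = 1 \<longleftrightarrow> (\<exists>I. w = encode I \<and> cwcm_instance I \<and> winnable I)"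
proof -
  let ?body = "Push rState2 (\<lambda>h. delta (h rState) (h rStream)) ;; Pop rState ;;
        Push rState (\<lambda>h. h rState2) ;; Pop rState2 ;; Pop rStream"
  let ?s1 = "s(rRaw := [], rInp := w)"
  \<comment> \<open>The initial state 0 is not stored at all: the empty stack reads as 0.\<close>
  let ?q = "\<lambda>u. if u = [] then [] else [foldl delta 0 u]"
  have 1: "run n (rev_onto rRaw rInp ;; copy rInp rStream) s = ?s1(rStream := w)"
    using s w n by (simp add: run_rev_onto run_copy)
  have 2: "run n (While (\<lambda>h. h rStream \<noteq> 0) ?body) (?s1(rStream := w)) = ?s1(rState := ?q w)"
  proof (rule run_While_list[where xs = w and \<sigma> = "\<lambda>ys zs. ?s1(rStream := zs, rState := ?q ys)"])
    fix ys x zs assume "w = ys @ x # zs"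
    then have "x \<noteq> 0" using w by auto
    let ?s = "?s1(rStream := x # zs, rState := ?q ys)"
    show "peek (?s rStream) \<noteq> 0 \<and> run n ?body ?s = ?s1(rStream := zs, rState := ?q (ys @ [x]))"
      using s \<open>x \<noteq> 0\<close> by (auto simp: fun_eq_iff)
  qed (use s n in \<open>auto simp: fun_eq_iff\<close>)
  have main: "run n main s = run n (When (\<lambda>h. h rState = 15) decide) (?s1(rState := ?q w))"
    unfolding main_def using 1 2 by simp
  show ?thesis
  proof (cases "foldl delta 0 w = 15")
    case True
    then obtain I where I: "w = encode I" using delta_accepts_iff by blast
    have "peek (run n decide (?s1(rState := ?q w)) rOut) = 1 \<longleftrightarrow> cwcm_instance I \<and> winnable I"
      using s n I by (intro run_decide) (auto simp: idle_def)
    moreover have "(\<exists>J. w = encode J \<and> cwcm_instance J \<and> winnable J) \<longleftrightarrow> cwcm_instance I \<and> winnable I"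
      using I inj_encode by (auto dest: injD)
    moreover have "w \<noteq> []" using True by auto
    ultimately show ?thesis using main True by simp
  next
    case False
    then have "\<not> (\<exists>I. w = encode I)" using delta_accepts_iff by blast
    then show ?thesis using main False s by simp
  qed
qed

lemma wf_main: "wf_prog 25 25 main"
  using wf_bit delta_less
  by (simp add: main_def decide_def check_candidates_def check_votes_def compute_bound_def
      compare_all_def score_prog_def vote_step_def wf_defs)

end

section \<open>Manipulation under the two rules\<close>

lemma position_append: "c \<notin> set xs \<Longrightarrow> position (xs @ c # ys) c = Suc (length xs)"
  unfolding position_def by (subst takeWhile_append2) auto

text \<open>Here \<open>k - i\<close> is \<open>length ys\<close>, the number of candidates ranked
  below \<open>c\<close>.\<close>

lemma round_down_append:
  assumes "c \<notin> set xs"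
  shows "round_down \<alpha> m (xs @ c # ys) c =
    (if length xs + length ys + 1 < m then \<alpha> m (m - length ys - 1) else \<alpha> m (length xs + 1))"
  using position_append[OF assms, of ys] by (simp add: round_down_def Let_def)

lemma round_down_plurality:
  assumes "top_truncated_vote C v" "finite C" "c \<in> C"
  shows "round_down plurality (card C) v c = (if 0 < plurality_hit (card C - length v) v c then 1 else 0)"
proof -
  have v: "v \<noteq> []" "distinct v" "set v \<subseteq> C" using assms(1) by (auto simp: top_truncated_vote_def)
  have k: "length v \<le> card C" using card_mono[OF assms(2) v(3)] distinct_card[OF v(2)] by simp
  show ?thesis
  proof (cases "c \<in> set v")
    case False
    \<comment> \<open>An unranked candidate gets the last entry of the vector, which for plurality
      is 0 except with one candidate. In that case every vote ranks it.\<close>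
    have "card C \<noteq> 1"
    proof
      assume "card C = 1"
      then obtain x where "C = {x}" by (rule card_1_singletonE)
      then have "set v = C" using v(1,3) subset_singletonD[of "set v" x] by auto
      then show False using False assms(3) by simp
    qed
    moreover have "hd v \<noteq> c" using False v(1) by auto
    ultimately show ?thesis using False by (simp add: round_down_def plurality_hit_def plurality_def)
  next
    case True
    then obtain xs ys where xs: "v = xs @ c # ys" "c \<notin> set xs" by (meson split_list_first)
    then have hd: "hd v = c \<longleftrightarrow> length xs = 0" by (cases xs) auto
    \<comment> \<open>For an incomplete vote, \<open>m - b - 1 = 1\<close> and
      \<open>a + b + 1 < m\<close> leave only \<open>a = 0\<close> and one unranked
      candidate.\<close>
    have arith: "(if a + b + 1 < m then m - b - 1 = 1 else a + 1 = 1) \<longleftrightarrow> m - (a + b + 1) \<le> 1 \<and> a = 0"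
      if "a + b + 1 \<le> m" for a b m :: nat using that by auto
    have len: "length v = length xs + length ys + 1" by (simp add: xs(1))
    have "0 < plurality_hit (card C - length v) v c \<longleftrightarrow> card C - length v \<le> 1 \<and> length xs = 0"
      by (simp add: plurality_hit_def hd)
    also have "\<dots> \<longleftrightarrow>
        (if length xs + length ys + 1 < card C then card C - length ys - 1 = 1 else length xs + 1 = 1)"
      unfolding len by (rule arith[symmetric]) (use k len in simp)
    finally show ?thesis
      unfolding xs(1) round_down_append[OF xs(2)] plurality_def by auto
  qed
qed

lemma round_down_veto:
  assumes "top_truncated_vote C v" "finite C" "c \<in> C"
  shows "round_down veto (card C) v c = (if 0 < veto_hit (card C - length v) v c then 1 else 0)"
proof -
  have v: "v \<noteq> []" "distinct v" "set v \<subseteq> C" using assms(1) by (auto simp: top_truncated_vote_def)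
  have k: "length v \<le> card C" using card_mono[OF assms(2) v(3)] distinct_card[OF v(2)] by simp
  have hit: "0 < veto_hit (card C - length v) v c \<longleftrightarrow>
      c \<in> set (if card C = length v then butlast v else v)"
    using k by (auto simp: veto_hit_def count_list_0_iff neq0_conv[symmetric] simp del: neq0_conv)
  show ?thesis
  proof (cases "c \<in> set v")
    case False
    then have "c \<notin> set (butlast v)" using in_set_butlastD by metis
    then show ?thesis using False hit by (simp add: round_down_def veto_def)
  next
    case True
    then obtain xs ys where xs: "v = xs @ c # ys" "c \<notin> set xs" by (meson split_list_first)
    then have butlast: "c \<in> set (butlast v) \<longleftrightarrow> length ys \<noteq> 0" using v(2) by (auto simp: butlast_append)
    have len: "length v = length xs + length ys + 1" by (simp add: xs(1))
    then have complete: "length xs + 1 \<noteq> card C \<longleftrightarrow> length ys \<noteq> 0" if "length v = card C"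
      using that by linarith
    have "0 < veto_hit (card C - length v) v c \<longleftrightarrow>
        (if length xs + length ys + 1 < card C then card C - length ys - 1 \<noteq> card C
         else length xs + 1 \<noteq> card C)"
      using hit True butlast complete len k by auto
    then show ?thesis
      unfolding xs(1) round_down_append[OF xs(2)] veto_def by auto
  qed
qed

text \<open>The favourable vote has to support \<open>p\<close> only if there is a rival: under veto
  a sole candidate is also the last one and gets no point, yet it wins.\<close>

locale scoring_rule_program = scoring_program +
  fixes \<alpha> :: scoring_rule
  assumes round_down_hit: "\<And>C v c. top_truncated_vote C v \<Longrightarrow> finite C \<Longrightarrow> c \<in> C \<Longrightarrow>
      round_down \<alpha> (card C) v c = (if 0 < hit (card C - length v) v c then 1 else 0)"
    and favourable: "\<And>C p. finite C \<Longrightarrow> p \<in> C \<Longrightarrow> \<exists>v. top_truncated_vote C v \<and>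
      (\<forall>d\<in>C. d \<noteq> p \<longrightarrow> 0 < hit (card C - length v) v p \<and> hit (card C - length v) v d = 0)"
begin

lemma score_eq_points:
  assumes "finite C" "\<forall>(w, v)\<in>set V. top_truncated_vote C v" "c \<in> C"
  shows "score \<alpha> C V c = points (card C) V c"
  unfolding score_def points_def
proof (rule arg_cong[of _ _ sum_list], rule map_cong)
  fix x assume x: "x \<in> set V"
  obtain w v where wv: "x = (w, v)" by (cases x)
  then have "top_truncated_vote C v" using assms(2) x by auto
  then show "(case x of (w, v) \<Rightarrow> w * round_down \<alpha> (card C) v c) =
      (case x of (w, v) \<Rightarrow> if 0 < hit (card C - length v) v c then w else 0)"
    using round_down_hit[of C v c] assms(1,3) wv by simp
qed simp

lemma manipulable_iff_winnable:
  assumes "cwcm_instance I"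
  shows "manipulable \<alpha> I \<longleftrightarrow> winnable I"
proof -
  obtain p L V W where I: "I = \<lparr>preferred = p, candidates = L, fixed_votes = V, manipulator_weights = W\<rparr>"
    by (cases I) auto
  let ?C = "set L" and ?m = "length L"
  have m: "card ?C = ?m" and p: "p \<in> ?C" and V: "\<forall>(w, v)\<in>set V. top_truncated_vote ?C v"
    using assms by (auto simp: cwcm_instance_def I distinct_card)
  have score: "score \<alpha> ?C (V @ zip W vs) c = points ?m V c + points ?m (zip W vs) c"
    if "\<forall>v\<in>set vs. top_truncated_vote ?C v" "c \<in> ?C" for vs c
    using that V m by (subst score_eq_points) (auto dest: set_zip_rightD)
  show ?thesis
  proof
    assume "manipulable \<alpha> I"
    then obtain vs where len: "length vs = length W" and vs: "\<forall>v\<in>set vs. top_truncated_vote ?C v"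
      and win: "p \<in> winners \<alpha> ?C (V @ zip W vs)"
      by (auto simp: manipulable_def I)
    have "(\<Sum>(w, v)\<leftarrow>zip W vs. w) = sum_list W"
    proof -
      have "map (\<lambda>(w, v). w) (zip W vs) = W" using len by (simp add: map_fst_zip case_prod_beta' fst_def[symmetric])
      then show ?thesis by simp
    qed
    \<comment> \<open>The total weight caps what \<open>p\<close> can gain, and no vote lowers a
      rival's score, so a victory with any votes implies the test.\<close>
    then have "points ?m (zip W vs) p \<le> sum_list W" using points_le by metis
    moreover have "points ?m V c + points ?m (zip W vs) c \<le> points ?m V p + points ?m (zip W vs) p"
      if "c \<in> ?C" for c
      using win that score[OF vs] p by (auto simp: winners_def)
    ultimately show "winnable I" by (fastforce simp: winnable_def I)
  next
    assume win: "winnable I"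
    obtain v where v: "top_truncated_vote ?C v"
      and fav: "\<forall>d\<in>?C. d \<noteq> p \<longrightarrow> 0 < hit (?m - length v) v p \<and> hit (?m - length v) v d = 0"
      using favourable[of ?C p] p m by auto
    let ?vs = "replicate (length W) v"
    have vs: "\<forall>v\<in>set ?vs. top_truncated_vote ?C v" using v by auto
    have points: "points ?m (zip U (replicate (length U) v)) c = (if 0 < hit (?m - length v) v c then sum_list U else 0)"
      for U c by (induction U) (auto simp: points_def)
    have "score \<alpha> ?C (V @ zip W ?vs) c \<le> score \<alpha> ?C (V @ zip W ?vs) p" if "c \<in> ?C" for c
    proof (cases "c = p")
      case False
      then show ?thesis
        using fav win that p by (auto simp: score[OF vs] points winnable_def I)
    qed simp
    then have "p \<in> winners \<alpha> ?C (V @ zip W ?vs)" using p by (simp add: winners_def)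
    then show "manipulable \<alpha> I" using vs unfolding manipulable_def I by (intro exI[of _ ?vs]) simp
  qed
qed

lemma binary_symbols: "set (binary k) \<subseteq> {1, 2}"
  using binary_digits by blast

lemma encode_in_lists: "encode I \<in> lists {1, 2, 3, 4}"
proof -
  have nums: "set (nums ks) \<subseteq> {1, 2, 3, 4}" for ks
    using binary_symbols by (induction ks) auto
  have votes: "set (vote_words V) \<subseteq> {1, 2, 3, 4}" for V
  proof (induction V)
    case (Cons x V)
    obtain w v where "x = (w, v)" by (cases x)
    then show ?case using Cons binary_symbols[of w] nums[of v] by auto
  qed simp
  show ?thesis
    using binary_symbols[of "preferred I"] nums[of "candidates I"] votes[of "fixed_votes I"]
      nums[of "manipulator_weights I"]
    unfolding encode_eq in_lists_conv_set by auto
qed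

lemma poly_time: "poly_time_decidable {1, 2, 3, 4} (CWCM_round_down \<alpha>)"
proof (rule poly_time_decidable_prog[OF wf_main, where out = rOut])
  show "CWCM_round_down \<alpha> \<subseteq> lists {1, 2, 3, 4}"
    using encode_in_lists by (auto simp: CWCM_round_down_def)
next
  fix w s
  assume "w \<in> lists {1, 2, 3, 4 :: nat}" and s: "s rRaw = rev w" "\<And>i. i < 25 \<Longrightarrow> i \<noteq> rRaw \<Longrightarrow> s i = []"
  then have "0 \<notin> set w" by auto
  with s have "peek (run (length w) main s rOut) = 1 \<longleftrightarrow> (\<exists>I. w = encode I \<and> cwcm_instance I \<and> winnable I)"
    by (intro run_main) simp_all
  then show "peek (run (length w) main s rOut) = 1 \<longleftrightarrow> w \<in> CWCM_round_down \<alpha>"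
    unfolding CWCM_round_down_def using manipulable_iff_winnable by blast
qed auto

end

text \<open>A vote for \<open>p\<close> alone is rounded down to no point as soon as there are three
  candidates, so the vote has to be complete. The order of the others does not matter.\<close>

interpretation plurality_rule: scoring_rule_program plurality_bit plurality_hit plurality
proof
  fix C :: "nat set" and p
  assume C: "finite C" "p \<in> C"
  obtain ys where ys: "set ys = C - {p}" "distinct ys"
    using C(1) finite_distinct_list[of "C - {p}"] by auto
  have set: "set (p # ys) = C" and "distinct (p # ys)" using ys C(2) by auto
  then have "top_truncated_vote C (p # ys)" "length (p # ys) = card C"
    using distinct_card[of "p # ys"] by (auto simp only: top_truncated_vote_def)
  then show "\<exists>v. top_truncated_vote C v \<and> (\<forall>d\<in>C. d \<noteq> p \<longrightarrow>
      0 < plurality_hit (card C - length v) v p \<and> plurality_hit (card C - length v) v d = 0)"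
    by (intro exI[of _ "p # ys"]) (simp add: plurality_hit_def)
qed (rule round_down_plurality)

interpretation veto_rule: scoring_rule_program veto_bit veto_hit veto
proof
  fix C :: "nat set" and p
  assume C: "finite C" "p \<in> C"
  \<comment> \<open>A rival makes \<open>[p]\<close> incomplete, so \<open>p\<close> is scored at
    position \<open>m - 1\<close>, which carries a point, and all rivals get the last entry
    0.\<close>
  have "0 < veto_hit (card C - 1) [p] p \<and> veto_hit (card C - 1) [p] d = 0" if "d \<in> C" "d \<noteq> p" for d
  proof -
    have "card {d, p} \<le> card C" using C that by (intro card_mono) auto
    then have "card C - 1 \<noteq> 0" using that by simp
    then show ?thesis using that by (simp add: veto_hit_def)
  qed
  then show "\<exists>v. top_truncated_vote C v \<and> (\<forall>d\<in>C. d \<noteq> p \<longrightarrow>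
      0 < veto_hit (card C - length v) v p \<and> veto_hit (card C - length v) v d = 0)"
    using C by (intro exI[of _ "[p]"]) (auto simp: top_truncated_vote_def)
qed (rule round_down_veto)

theorem theorem3:
  "poly_time_decidable {1, 2, 3, 4} (CWCM_round_down plurality) \<and>
   poly_time_decidable {1, 2, 3, 4} (CWCM_round_down veto)"
  using plurality_rule.poly_time veto_rule.poly_time by simp

end
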